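(* Let $\mathfrak b\in\mathcal B^d$ be a decreasing Borel subalgebra of $\mathfrak{gl}(m|2n)$ and $\lambda\in\mathscr H(m|n)$. For $1\le i\le m$ put $\ell(\lambda,i,\mathfrak b)=\min\{\ell_{i,\mathfrak b},2\lambda_i\}$. Then $r(\lambda,\mathfrak b)=\sum_{\alpha\in\mathcal N_{\mathfrak b}}\alpha$, where $\mathcal N_{\mathfrak b}$ is the set of roots $$\mathcal N_{\mathfrak b}=\{\delta_k-\epsilon_i \mid 1\le i\le m,\ 1\le k\le\ell(\lambda,i,\mathfrak b)\}$$ (with no roots for those $i$ with $\ell(\lambda,i,\mathfrak b)=0$). In particular, $\underline\lambda_{\mathfrak b}=\underline\lambda_0-r(\lambda,\mathfrak b)$ is the $\mathfrak b$-highest weight of $W_\lambda$.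
   Context: The base field is $\mathbb C$; $m,n\ge0$ are integers, $\mathfrak g=\mathfrak{gl}(m|2n)$, $\mathfrak h$ the diagonal Cartan subalgebra, with basis $\epsilon_1,\dots,\epsilon_m,\delta_1,\dots,\delta_{2n}$ of $\mathfrak h^*$ dual to the standard basis; $(\cdot,\cdot)$ is the bilinear form on $\mathfrak h^*$, diagonal in this basis, with $(\epsilon_i,\epsilon_i)=1$, $(\delta_j,\delta_j)=-1$. $\mathscr H(m|n)$ is the set of partitions $\lambda$ with $\lambda_{m+1}\le n$; $\lambda'$ is the transpose. $W_\lambda$ is the irreducible finite-dimensional $\mathfrak g$-module whose highest weight with respect to the lower triangular Borel subalgebra $\mathfrak b^{\mathrm{op}}$ is $\underline\lambda_0=-\sum_{i=1}^m2\lambda_i\epsilon_i-\sum_{j=1}^n\mu_j(\delta_{2j-1}+\delta_{2j})$, $\mu_j=\max\{0,\lambda'_j-m\}$. For a Borel subalgebra $\mathfrak b\supseteq\mathfrak h$, $\underline\lambda_{\mathfrak b}$ denotes the $\mathfrak b$-highest weight of $W_\lambda$. A Borel subalgebra containing $\mathfrak h$ is encoded by the ordering $\xi_1,\dots,\xi_{m+2n}$ of $\{\epsilon_i,\delta_j\}$ such that $\xi_i-\xi_{i+1}$ are its simple roots ($\delta\epsilon$ sequence). $\mathcal B^d$ is the set of decreasing ones: the indices of the $\epsilon$'s and the indices of the $\delta$'s each decrease from left to right (e.g. $\mathfrak b^{\mathrm{op}}$: $\delta_{2n}\cdots\delta_1\epsilon_m\cdots\epsilon_1$). $\ell_{i,\mathfrak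 b}$ is the number of $\delta$'s to the right of $\epsilon_i$ in the sequence of $\mathfrak b$. Each $\mathfrak b\in\mathcal B^d$ is obtained from $\mathfrak b^{\mathrm{op}}$ by successive odd reflections in the simple odd roots (listed in order) $\delta_1-\epsilon_m,\dots,\delta_{\ell_{m,\mathfrak b}}-\epsilon_m;\ \delta_1-\epsilon_{m-1},\dots,\delta_{\ell_{m-1,\mathfrak b}}-\epsilon_{m-1};\ \dots;\ \delta_1-\epsilon_1,\dots,\delta_{\ell_{1,\mathfrak b}}-\epsilon_1$; denote this set $\mathcal G_{\mathfrak b}$. When passing from $\mathfrak b'$ to $\mathfrak b''=r_\alpha(\mathfrak b')$, one has $\underline\lambda_{\mathfrak b''}=\underline\lambda_{\mathfrak b'}-\alpha$ if $(\underline\lambda_{\mathfrak b'},\alpha)\ne0$ and $\underline\lambda_{\mathfrak b''}=\underline\lambda_{\mathfrak b'}$ otherwise. $\mathcal N_{\mathfrak b}\subseteq\mathcal G_{\mathfrak b}$ denotes the set of those roots $\alpha$ in this sequence which are actually subtracted (i.e. for which $(\underline\lambda_{\mathfrak b'},\alpha)\neq 0$), and $r(\lambda,\mathfrak b):=\sum_{\alpha\in\mathcal N_{\mathfrak b}}\alpha$, so $\underline\lambda_{\mathfrak b}=\underline\lambda_0-r(\lambda,\mathfrak b)$. *)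

theory Defs
  imports
    "Jordan_Normal_Form.Matrix"
    "HOL-Library.Poly_Mapping"
    "HOL-Library.Z2"
    "HOL-Combinatorics.Transposition"
begin

section \<open>Weights of gl(m|2n)\<close>

text \<open>
  \<open>Eps i\<close> and \<open>Del j\<close> (with indices starting from 1) name the basis
  \<open>\<epsilon>\<^sub>1, \<dots>, \<epsilon>\<^sub>m, \<delta>\<^sub>1, \<dots>, \<delta>\<^sub>2\<^sub>n\<close> of the dual of the diagonal Cartan subalgebra, and also the
  corresponding standard basis vectors of the natural module.
\<close>

datatype label = Eps nat | Del nat

definition labels :: "nat \<Rightarrow> nat \<Rightarrow> label set" where
  "labels m n = Eps ` {1..m} \<union> Del ` {1..2 * n}"

text \<open>
  A weight is given by its coordinates in this basis; it belongs to \<open>weights m n\<close> if only the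
  basis elements of gl(m|2n) occur.
\<close>

type_synonym weight = "label \<Rightarrow>\<^sub>0 complex"

definition weights :: "nat \<Rightarrow> nat \<Rightarrow> weight set" where
  "weights m n = {\<mu>. Poly_Mapping.keys \<mu> \<subseteq> labels m n}"

abbreviation eps :: "nat \<Rightarrow> weight" where
  "eps i \<equiv> Poly_Mapping.single (Eps i) 1"

abbreviation del :: "nat \<Rightarrow> weight" where
  "del j \<equiv> Poly_Mapping.single (Del j) 1"

definition weight_form :: "nat \<Rightarrow> nat \<Rightarrow> weight \<Rightarrow> weight \<Rightarrow> complex" where
  "weight_form m n \<mu> \<nu> =
     (\<Sum>i = 1..m. Poly_Mapping.lookup \<mu> (Eps i) * Poly_Mapping.lookup \<nu> (Eps i))
     - (\<Sum>j = 1..2 * n. Poly_Mapping.lookup \<mu> (Del j) * Poly_Mapping.lookup \<nu> (Del j))"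


section \<open>The Lie superalgebra gl(m|2n) and its modules\<close>

text \<open>
  Matrices have size \<open>m + 2 * n\<close>. Rows and columns are numbered from 0, the even basis vectors
  coming first, so \<open>\<epsilon>\<^sub>i\<close> sits at position \<open>i - 1\<close> and \<open>\<delta>\<^sub>j\<close> at position \<open>m + j - 1\<close>.
\<close>

definition gl_carrier :: "nat \<Rightarrow> nat \<Rightarrow> complex mat set" where
  "gl_carrier m n = carrier_mat (m + 2 * n) (m + 2 * n)"

definition index_parity :: "nat \<Rightarrow> nat \<Rightarrow> bit" where
  "index_parity m a = (if a < m then 0 else 1)"

definition gl_homogeneous :: "nat \<Rightarrow> nat \<Rightarrow> bit \<Rightarrow> complex mat set" where
  "gl_homogeneous m n p =
     {A \<in> gl_carrier m n. \<forall>a < m + 2 * n. \<forall>b < m + 2 * n.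
        A $$ (a, b) \<noteq> 0 \<longrightarrow> index_parity m a + index_parity m b = p}"

definition super_sign :: "bit \<Rightarrow> bit \<Rightarrow> complex" where
  "super_sign p q = (if p = 1 \<and> q = 1 then - 1 else 1)"

definition superbracket :: "bit \<Rightarrow> bit \<Rightarrow> complex mat \<Rightarrow> complex mat \<Rightarrow> complex mat" where
  "superbracket p q A B = A * B - super_sign p q \<cdot>\<^sub>m (B * A)"

locale gl_supermodule = vector_space scale
  for scale :: "complex \<Rightarrow> 'v::ab_group_add \<Rightarrow> 'v" +
  fixes m n :: nat
    and V :: "bit \<Rightarrow> 'v set"
    and \<rho> :: "complex mat \<Rightarrow> 'v \<Rightarrow> 'v"
  assumes grading_subspace: "subspace (V p)"
    and grading_disjoint: "V 0 \<inter> V 1 = {0}"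
    and grading_spans: "\<exists>v\<^sub>0 \<in> V 0. \<exists>v\<^sub>1 \<in> V 1. v = v\<^sub>0 + v\<^sub>1"
    and action_linear: "A \<in> gl_carrier m n \<Longrightarrow> Vector_Spaces.linear scale scale (\<rho> A)"
    and action_add:
      "A \<in> gl_carrier m n \<Longrightarrow> B \<in> gl_carrier m n \<Longrightarrow> \<rho> (A + B) v = \<rho> A v + \<rho> B v"
    and action_smult: "A \<in> gl_carrier m n \<Longrightarrow> \<rho> (c \<cdot>\<^sub>m A) v = scale c (\<rho> A v)"
    and action_parity: "A \<in> gl_homogeneous m n p \<Longrightarrow> v \<in> V q \<Longrightarrow> \<rho> A v \<in> V (p + q)"
    and action_superbracket:
      "A \<in> gl_homogeneous m n p \<Longrightarrow> B \<in> gl_homogeneous m n q \<Longrightarrow>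
        \<rho> (superbracket p q A B) v = \<rho> A (\<rho> B v) - scale (super_sign p q) (\<rho> B (\<rho> A v))"
begin

definition subsupermodule :: "'v set \<Rightarrow> bool" where
  "subsupermodule U \<longleftrightarrow>
     subspace U \<and>
     (\<forall>u \<in> U. \<exists>u\<^sub>0 \<in> U \<inter> V 0. \<exists>u\<^sub>1 \<in> U \<inter> V 1. u = u\<^sub>0 + u\<^sub>1) \<and>
     (\<forall>A \<in> gl_carrier m n. \<forall>u \<in> U. \<rho> A u \<in> U)"

end

locale irreducible_fd_gl_supermodule = gl_supermodule scale m n V \<rho>
  for scale :: "complex \<Rightarrow> 'v::ab_group_add \<Rightarrow> 'v"
    and m n :: nat
    and V :: "bit \<Rightarrow> 'v set"
    and \<rho> :: "complex mat \<Rightarrow> 'v \<Rightarrow> 'v" +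
  assumes finite_dimensional: "\<exists>B. finite B \<and> span B = UNIV"
    and nonzero: "(UNIV :: 'v set) \<noteq> {0}"
    and irreducible: "subsupermodule U \<Longrightarrow> U = {0} \<or> U = UNIV"


section \<open>Borel subalgebras and highest weights\<close>

text \<open>
  A Borel subalgebra containing the Cartan subalgebra is encoded by its \<open>\<delta>\<epsilon>\<close> sequence
  \<open>\<xi>\<^sub>1, \<xi>\<^sub>2, \<dots>\<close>; its simple roots are the differences of consecutive entries, hence its roots
  are the differences \<open>x - y\<close> where \<open>x\<close> precedes \<open>y\<close>. The root space of \<open>x - y\<close> is spanned by the
  elementary matrix with row \<open>x\<close> and column \<open>y\<close>.
\<close>

definition borel_sequences :: "nat \<Rightarrow> nat \<Rightarrow> label list set" where
  "borel_sequences m n = {xs. distinct xs \<and> set xs = labels m n}"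

definition precedes :: "label list \<Rightarrow> label \<Rightarrow> label \<Rightarrow> bool" where
  "precedes xs x y \<longleftrightarrow> (\<exists>i j. i < j \<and> j < length xs \<and> xs ! i = x \<and> xs ! j = y)"

fun position :: "nat \<Rightarrow> label \<Rightarrow> nat" where
  "position m (Eps i) = i - 1"
| "position m (Del j) = m + j - 1"

definition cartan :: "nat \<Rightarrow> nat \<Rightarrow> complex mat set" where
  "cartan m n = {H \<in> gl_carrier m n. diagonal_mat H}"

definition borel :: "nat \<Rightarrow> nat \<Rightarrow> label list \<Rightarrow> complex mat set" where
  "borel m n xs =
     {A \<in> gl_carrier m n. \<forall>x \<in> labels m n. \<forall>y \<in> labels m n.
        A $$ (position m x, position m y) \<noteq> 0 \<longrightarrow> x = y \<or> precedes xs x y}"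

definition borel_nilradical :: "nat \<Rightarrow> nat \<Rightarrow> label list \<Rightarrow> complex mat set" where
  "borel_nilradical m n xs = {A \<in> borel m n xs. \<forall>a < m + 2 * n. A $$ (a, a) = 0}"

definition eval_weight :: "nat \<Rightarrow> nat \<Rightarrow> weight \<Rightarrow> complex mat \<Rightarrow> complex" where
  "eval_weight m n \<mu> H = (\<Sum>x \<in> labels m n. Poly_Mapping.lookup \<mu> x * H $$ (position m x, position m x))"

definition has_highest_weight ::
  "(complex \<Rightarrow> 'v::ab_group_add \<Rightarrow> 'v) \<Rightarrow> nat \<Rightarrow> nat \<Rightarrow> (complex mat \<Rightarrow> 'v \<Rightarrow> 'v) \<Rightarrow>
    label list \<Rightarrow> weight \<Rightarrow> bool" where
  "has_highest_weight scale m n \<rho> xs \<mu> \<longleftrightarrow>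
     \<mu> \<in> weights m n \<and>
     (\<exists>v. v \<noteq> 0 \<and>
        (\<forall>H \<in> cartan m n. \<rho> H v = scale (eval_weight m n \<mu> H) v) \<and>
        (\<forall>A \<in> borel_nilradical m n xs. \<rho> A v = 0))"

text \<open>Meaningful for irreducible finite-dimensional modules, where the highest weight is unique.\<close>

definition highest_weight ::
  "(complex \<Rightarrow> 'v::ab_group_add \<Rightarrow> 'v) \<Rightarrow> nat \<Rightarrow> nat \<Rightarrow> (complex mat \<Rightarrow> 'v \<Rightarrow> 'v) \<Rightarrow>
    label list \<Rightarrow> weight" where
  "highest_weight scale m n \<rho> xs = (THE \<mu>. has_highest_weight scale m n \<rho> xs \<mu>)"


section \<open>Decreasing Borel subalgebras and odd reflections\<close>

definition decreasing_borels :: "nat \<Rightarrow> nat \<Rightarrow> label list set" where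
  "decreasing_borels m n =
     {xs \<in> borel_sequences m n.
        (\<forall>i j. precedes xs (Eps i) (Eps j) \<longrightarrow> j < i) \<and>
        (\<forall>i j. precedes xs (Del i) (Del j) \<longrightarrow> j < i)}"

definition borel_op :: "nat \<Rightarrow> nat \<Rightarrow> label list" where
  "borel_op m n = map Del (rev [1..<Suc (2 * n)]) @ map Eps (rev [1..<Suc m])"

definition dels_right :: "label list \<Rightarrow> nat \<Rightarrow> nat" where
  "dels_right xs i = card {k. precedes xs (Eps i) (Del k)}"

text \<open>
  The reflection in a simple root \<open>x - y\<close>, where \<open>x\<close> and \<open>y\<close> are adjacent in the sequence,
  interchanges these two entries.
\<close>

definition reflect :: "label \<times> label \<Rightarrow> label list \<Rightarrow> label list" where
  "reflect p xs = map (Transposition.transpose (fst p) (snd p)) xs"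

definition root :: "label \<times> label \<Rightarrow> weight" where
  "root p = Poly_Mapping.single (fst p) 1 - Poly_Mapping.single (snd p) 1"

text \<open>
  The odd roots leading from the lower triangular Borel subalgebra to \<open>xs\<close>, in the order
  \<open>\<delta>\<^sub>1 - \<epsilon>\<^sub>m, \<delta>\<^sub>2 - \<epsilon>\<^sub>m, \<dots>; \<delta>\<^sub>1 - \<epsilon>\<^sub>m\<^sub>-\<^sub>1, \<dots>; \<dots>; \<delta>\<^sub>1 - \<epsilon>\<^sub>1, \<dots>\<close>. The pair \<open>(x, y)\<close> stands for
  the root \<open>x - y\<close>.
\<close>

definition reflection_roots :: "nat \<Rightarrow> label list \<Rightarrow> (label \<times> label) list" where
  "reflection_roots m xs =
     concat (map (\<lambda>i. map (\<lambda>k. (Del k, Eps i)) [1..<Suc (dels_right xs i)]) (rev [1..<Suc m]))"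

definition intermediate_borel :: "nat \<Rightarrow> nat \<Rightarrow> label list \<Rightarrow> nat \<Rightarrow> label list" where
  "intermediate_borel m n xs t = fold reflect (take t (reflection_roots m xs)) (borel_op m n)"

text \<open>
  The set \<open>\<N>\<^sub>\<b>\<close> of the roots that are actually subtracted from the highest weight of the given
  module, and their sum.
\<close>

definition subtracted_roots ::
  "(complex \<Rightarrow> 'v::ab_group_add \<Rightarrow> 'v) \<Rightarrow> nat \<Rightarrow> nat \<Rightarrow> (complex mat \<Rightarrow> 'v \<Rightarrow> 'v) \<Rightarrow>
    label list \<Rightarrow> weight set" where
  "subtracted_roots scale m n \<rho> xs =
     {root (reflection_roots m xs ! t) | t.
        t < length (reflection_roots m xs) \<and>
        weight_form m n (highest_weight scale m n \<rho> (intermediate_borel m n xs t))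
          (root (reflection_roots m xs ! t)) \<noteq> 0}"

definition subtracted_sum ::
  "(complex \<Rightarrow> 'v::ab_group_add \<Rightarrow> 'v) \<Rightarrow> nat \<Rightarrow> nat \<Rightarrow> (complex mat \<Rightarrow> 'v \<Rightarrow> 'v) \<Rightarrow>
    label list \<Rightarrow> weight" where
  "subtracted_sum scale m n \<rho> xs = (\<Sum>\<alpha> \<in> subtracted_roots scale m n \<rho> xs. \<alpha>)"


section \<open>Hook partitions\<close>

text \<open>
  A partition is a sequence \<open>lam 1 \<ge> lam 2 \<ge> \<dots>\<close> with finitely many nonzero terms; the value \<open>lam 0\<close> is
  irrelevant.
\<close>

definition is_partition :: "(nat \<Rightarrow> nat) \<Rightarrow> bool" where
  "is_partition lam \<longleftrightarrow> (\<forall>i \<ge> 1. lam (Suc i) \<le> lam i) \<and> finite {i. 1 \<le> i \<and> lam i \<noteq> 0}"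

text \<open>The \<open>j\<close>-th part of the transposed partition, for \<open>j \<ge> 1\<close>.\<close>

definition transposed_part :: "(nat \<Rightarrow> nat) \<Rightarrow> nat \<Rightarrow> nat" where
  "transposed_part lam j = card {i. 1 \<le> i \<and> j \<le> lam i}"

definition hook_partitions :: "nat \<Rightarrow> nat \<Rightarrow> (nat \<Rightarrow> nat) set" where
  "hook_partitions m n = {lam. is_partition lam \<and> lam (m + 1) \<le> n}"

text \<open>
  The highest weight \<open>\<lambda>\<^sub>0\<close> with respect to the lower triangular Borel subalgebra; the truncated
  subtraction is \<open>\<mu>\<^sub>j = max {0, \<lambda>'\<^sub>j - m}\<close>.
\<close>

definition hook_weight :: "nat \<Rightarrow> nat \<Rightarrow> (nat \<Rightarrow> nat) \<Rightarrow> weight" where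
  "hook_weight m n lam =
     - (\<Sum>i = 1..m. Poly_Mapping.single (Eps i) (of_nat (2 * lam i)))
     - (\<Sum>j = 1..n. Poly_Mapping.single (Del (2 * j - 1)) (of_nat (transposed_part lam j - m))
                  + Poly_Mapping.single (Del (2 * j)) (of_nat (transposed_part lam j - m)))"

end

theory Submission
  imports Defs
begin

text \<open>
  Write \<open>E\<^sub>x\<^sub>y\<close> for the elementary matrices. If \<open>v\<close> is a highest weight vector of weight \<open>\<mu>\<close> and
  \<open>\<alpha> = x - y\<close> is an odd simple root, then \<open>E\<^sub>y\<^sub>x v\<close> is killed by all positive root vectors of the
  reflected Borel subalgebra, and \<open>E\<^sub>x\<^sub>y E\<^sub>y\<^sub>x v\<close> is \<open>v\<close> times \<open>\<plusminus>(\<mu>, \<alpha>)\<close>. If \<open>(\<mu>, \<alpha>) = 0\<close>, then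
  \<open>E\<^sub>y\<^sub>x v\<close> would be a highest weight vector of weight \<open>\<mu> - \<alpha>\<close> for the old Borel subalgebra, so it
  vanishes because the highest weight is unique.

  At the step \<open>\<delta>\<^sub>k - \<epsilon>\<^sub>i\<close> the form equals
  \<open>max {0, \<lambda>'\<^sub>\<lceil>\<^sub>k\<^sub>/\<^sub>2\<^sub>\<rceil> - m} + #{i' > i. k \<le> 2\<lambda>\<^sub>i\<^sub>'} + 2\<lambda>\<^sub>i - min {k - 1, 2\<lambda>\<^sub>i}\<close>. It is positive for
  \<open>k \<le> 2\<lambda>\<^sub>i\<close>; otherwise all three contributions vanish because \<open>\<lambda>\<close> is decreasing.
\<close>

section \<open>Sequences and elementary matrices\<close>

lemma precedes_Nil [simp]: "\<not> precedes [] a b"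
  by (simp add: precedes_def)

lemma precedes_Cons [simp]:
  "precedes (x # xs) a b \<longleftrightarrow> a = x \<and> b \<in> set xs \<or> precedes xs a b"
proof
  assume "precedes (x # xs) a b"
  then obtain i j where ij: "i < j" "j < Suc (length xs)" "(x # xs) ! i = a" "(x # xs) ! j = b"
    by (auto simp: precedes_def)
  then obtain j' where j': "j = Suc j'" by (cases j) auto
  show "a = x \<and> b \<in> set xs \<or> precedes xs a b"
    using ij j' by (cases i) (auto simp: precedes_def)
next
  assume "a = x \<and> b \<in> set xs \<or> precedes xs a b"
  then show "precedes (x # xs) a b"
  proof
    assume "a = x \<and> b \<in> set xs"
    then obtain j where "j < length xs" "xs ! j = b" "a = x" by (auto simp: in_set_conv_nth)
    then show ?thesis unfolding precedes_def by (intro exI[of _ 0] exI[of _ "Suc j"]) auto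
  next
    assume "precedes xs a b"
    then obtain i j where "i < j" "j < length xs" "xs ! i = a" "xs ! j = b"
      by (auto simp: precedes_def)
    then show ?thesis unfolding precedes_def by (intro exI[of _ "Suc i"] exI[of _ "Suc j"]) auto
  qed
qed

lemma precedes_append [simp]:
  "precedes (xs @ ys) a b \<longleftrightarrow> precedes xs a b \<or> precedes ys a b \<or> a \<in> set xs \<and> b \<in> set ys"
  by (induction xs) auto

lemma precedes_in_set: "precedes xs a b \<Longrightarrow> a \<in> set xs \<and> b \<in> set xs"
  by (induction xs) auto

text \<open>The index in the list serves as \<open>r\<close>. A rank with natural values turns the
  order of the Borel subalgebra into numbers, from which a grading by height can be built.\<close>

lemma precedes_rank:
  assumes "distinct xs"
  obtains r :: "label \<Rightarrow> nat" where
    "inj_on r (set xs)"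
    "\<And>x y. x \<in> set xs \<Longrightarrow> y \<in> set xs \<Longrightarrow> precedes xs x y \<longleftrightarrow> r x < r y"
proof -
  have "\<forall>x \<in> set xs. \<exists>i. i < length xs \<and> xs ! i = x" by (auto simp: in_set_conv_nth)
  then obtain r where r: "\<And>x. x \<in> set xs \<Longrightarrow> r x < length xs \<and> xs ! r x = x"
    by metis
  have "inj_on r (set xs)" using r by (metis inj_onI)
  moreover have "precedes xs x y \<longleftrightarrow> r x < r y" if "x \<in> set xs" "y \<in> set xs" for x y
  proof
    assume "precedes xs x y"
    then obtain i j where "i < j" "j < length xs" "xs ! i = x" "xs ! j = y"
      by (auto simp: precedes_def)
    moreover have "r x = i" "r y = j"
      using r[OF that(1)] r[OF that(2)] calculation assms
      by (metis distinct_conv_nth dual_order.strict_trans)+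
    ultimately show "r x < r y" by simp
  next
    assume "r x < r y"
    then show "precedes xs x y" using r that unfolding precedes_def by blast
  qed
  ultimately show ?thesis using that by blast
qed

section \<open>Positions of labels and products of elementary matrices\<close>

lemma finite_labels [simp]: "finite (labels m n)"
  by (simp add: labels_def)

lemma position_less: "x \<in> labels m n \<Longrightarrow> position m x < m + 2 * n"
  by (auto simp: labels_def)

lemma position_eq_iff:
  "x \<in> labels m n \<Longrightarrow> y \<in> labels m n \<Longrightarrow> position m x = position m y \<longleftrightarrow> x = y"
  by (auto simp: labels_def)

lemma position_surj:
  assumes "a < m + 2 * n"
  obtains x where "x \<in> labels m n" "position m x = a"
proof (cases "a < m")
  case True
  then show ?thesis by (intro that[of "Eps (Suc a)"]) (auto simp: labels_def)
next
  case False
  then have "Suc a - m \<in> {1..2 * n}" using assms by auto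
  then have "Del (Suc a - m) \<in> labels m n" unfolding labels_def by blast
  moreover have "position m (Del (Suc a - m)) = a" using False by simp
  ultimately show ?thesis using that by blast
qed

fun label_parity :: "label \<Rightarrow> bit" where
  "label_parity (Eps i) = 0"
| "label_parity (Del j) = 1"

lemma index_parity_position: "x \<in> labels m n \<Longrightarrow> index_parity m (position m x) = label_parity x"
  by (cases x) (auto simp: labels_def index_parity_def simp flip: One_nat_def)

definition unit_mat :: "nat \<Rightarrow> nat \<Rightarrow> label \<Rightarrow> label \<Rightarrow> complex mat" where
  "unit_mat m n x y =
     mat (m + 2 * n) (m + 2 * n) (\<lambda>(a, b). if a = position m x \<and> b = position m y then 1 else 0)"

lemma unit_mat_carrier [simp]: "unit_mat m n x y \<in> carrier_mat (m + 2 * n) (m + 2 * n)"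
  by (simp add: unit_mat_def)

lemma unit_mat_gl [simp]: "unit_mat m n x y \<in> gl_carrier m n"
  by (simp add: gl_carrier_def)

lemma unit_mat_index:
  "\<lbrakk>x \<in> labels m n; y \<in> labels m n; z \<in> labels m n; w \<in> labels m n\<rbrakk> \<Longrightarrow>
    unit_mat m n x y $$ (position m z, position m w) = (if z = x \<and> w = y then 1 else 0)"
  by (simp add: unit_mat_def position_less position_eq_iff)

lemma gl_carrier_eqI:
  assumes "A \<in> gl_carrier m n" "B \<in> gl_carrier m n"
    and "\<And>x y. x \<in> labels m n \<Longrightarrow> y \<in> labels m n \<Longrightarrow>
      A $$ (position m x, position m y) = B $$ (position m x, position m y)"
  shows "A = B"
proof (rule eq_matI)
  fix a b assume "a < dim_row B" "b < dim_col B"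
  then have "a < m + 2 * n" "b < m + 2 * n" using assms(2) by (auto simp: gl_carrier_def)
  then show "A $$ (a, b) = B $$ (a, b)" using assms(3) by (metis position_surj)
qed (use assms in \<open>auto simp: gl_carrier_def\<close>)

lemma unit_mat_mult:
  assumes "x \<in> labels m n" "y \<in> labels m n" "z \<in> labels m n" "w \<in> labels m n"
  shows "unit_mat m n x y * unit_mat m n z w =
    (if y = z then unit_mat m n x w else 0\<^sub>m (m + 2 * n) (m + 2 * n))"
proof (rule eq_matI)
  fix a b
  assume "a < dim_row (if y = z then unit_mat m n x w else 0\<^sub>m (m + 2 * n) (m + 2 * n))"
    "b < dim_col (if y = z then unit_mat m n x w else 0\<^sub>m (m + 2 * n) (m + 2 * n))"
  then have ab: "a < m + 2 * n" "b < m + 2 * n" by (auto simp: unit_mat_def split: if_splits)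
  have "(unit_mat m n x y * unit_mat m n z w) $$ (a, b) =
    (\<Sum>c = 0..<m + 2 * n. (if a = position m x \<and> c = position m y then 1 else 0) *
      (if c = position m z \<and> b = position m w then 1 else 0))"
    using ab by (simp add: unit_mat_def scalar_prod_def)
  also have "\<dots> = (\<Sum>c = 0..<m + 2 * n. if c = position m y then
      (if a = position m x \<and> y = z \<and> b = position m w then 1 else 0) else 0)"
    using assms by (intro sum.cong) (auto simp: position_eq_iff)
  also have "\<dots> = (if a = position m x \<and> y = z \<and> b = position m w then 1 else 0)"
    using position_less[OF assms(2)] by simp
  also have "\<dots> = (if y = z then unit_mat m n x w else 0\<^sub>m (m + 2 * n) (m + 2 * n)) $$ (a, b)"
    using ab by (simp add: unit_mat_def)
  finally show "(unit_mat m n x y * unit_mat m n z w) $$ (a, b) = \<dots>" .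
qed (auto simp: unit_mat_def)

lemma unit_mat_homogeneous:
  assumes "x \<in> labels m n" "y \<in> labels m n"
  shows "unit_mat m n x y \<in> gl_homogeneous m n (label_parity x + label_parity y)"
  using index_parity_position[OF assms(1)] index_parity_position[OF assms(2)]
  unfolding gl_homogeneous_def by (auto simp: unit_mat_def gl_carrier_def split: if_splits)

section \<open>The action of elementary matrices\<close>

context gl_supermodule
begin

abbreviation e :: "label \<Rightarrow> label \<Rightarrow> 'v \<Rightarrow> 'v" where
  "e x y \<equiv> \<rho> (unit_mat m n x y)"

lemma action_hom: "A \<in> gl_carrier m n \<Longrightarrow> module_hom scale scale (\<rho> A)"
  using action_linear unfolding Vector_Spaces.linear_def by blast

lemma e_add: "e x y (u + v) = e x y u + e x y v"
  and e_scale: "e x y (scale c v) = scale c (e x y v)"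
  and e_zero [simp]: "e x y 0 = 0"
  and e_sum: "e x y (sum f S) = (\<Sum>s\<in>S. e x y (f s))"
  using module_hom.add[OF action_hom[OF unit_mat_gl]] module_hom.scale[OF action_hom[OF unit_mat_gl]]
    module_hom.zero[OF action_hom[OF unit_mat_gl]] module_hom.sum[OF action_hom[OF unit_mat_gl]]
  by auto

lemma action_zero_mat: "\<rho> (0\<^sub>m (m + 2 * n) (m + 2 * n)) v = 0"
proof -
  have "(0 :: complex) \<cdot>\<^sub>m 0\<^sub>m (m + 2 * n) (m + 2 * n) = 0\<^sub>m (m + 2 * n) (m + 2 * n)"
    by (intro eq_matI) auto
  then show ?thesis
    using action_smult[of "0\<^sub>m (m + 2 * n) (m + 2 * n)" 0 v] by (simp add: gl_carrier_def)
qed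

text \<open>Linearity in the matrix is given only for two summands and for scalar multiples, so the
  entries are added one by one. This reduces every statement about the Cartan and Borel subalgebras
  to elementary matrices.\<close>

lemma action_expand:
  assumes A: "A \<in> gl_carrier m n"
  shows "\<rho> A v = (\<Sum>(x, y) \<in> labels m n \<times> labels m n.
    scale (A $$ (position m x, position m y)) (e x y v))"
proof -
  define N where "N = m + 2 * n"
  \<comment> \<open>\<open>restr S\<close> keeps the entries of \<open>A\<close> indexed by
    \<open>S\<close> and puts 0 elsewhere, so enlarging \<open>S\<close> by one pair adds one
    multiple of an elementary matrix.\<close>
  define restr where "restr S = mat N N (\<lambda>(a, b).
    if \<exists>(x, y) \<in> S. a = position m x \<and> b = position m y then A $$ (a, b) else 0)" for S
  have restr_gl: "restr S \<in> gl_carrier m n" for S by (simp add: restr_def gl_carrier_def N_def)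
  have restr_index: "restr S $$ (position m x, position m y) =
      (if (x, y) \<in> S then A $$ (position m x, position m y) else 0)"
    if "S \<subseteq> labels m n \<times> labels m n" "x \<in> labels m n" "y \<in> labels m n" for S x y
  proof -
    have "(\<exists>(x', y') \<in> S. position m x = position m x' \<and> position m y = position m y') \<longleftrightarrow> (x, y) \<in> S"
      using that by (force simp: position_eq_iff)
    then show ?thesis using that by (simp add: restr_def N_def position_less)
  qed
  have "\<rho> (restr S) v = (\<Sum>(x, y) \<in> S. scale (A $$ (position m x, position m y)) (e x y v))"
    if "finite S" "S \<subseteq> labels m n \<times> labels m n" for S
    using that
  proof (induction S rule: finite_induct)
    case empty
    have "restr {} = 0\<^sub>m N N" by (intro eq_matI) (auto simp: restr_def)
    then show ?case using action_zero_mat by (simp add: N_def)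
  next
    case (insert p S)
    obtain x y where p: "p = (x, y)" by force
    let ?c = "A $$ (position m x, position m y)"
    have xy: "x \<in> labels m n" "y \<in> labels m n" and S: "S \<subseteq> labels m n \<times> labels m n"
      using insert.prems p by auto
    have gl: "?c \<cdot>\<^sub>m unit_mat m n x y \<in> gl_carrier m n"
      by (simp add: gl_carrier_def)
    have "restr (insert p S) = restr S + ?c \<cdot>\<^sub>m unit_mat m n x y"
    proof (rule gl_carrier_eqI)
      show "restr S + ?c \<cdot>\<^sub>m unit_mat m n x y \<in> gl_carrier m n"
        using restr_gl[of S] by (simp add: gl_carrier_def)
      fix z w assume zw: "z \<in> labels m n" "w \<in> labels m n"
      have "(restr S + ?c \<cdot>\<^sub>m unit_mat m n x y) $$ (position m z, position m w) =
          restr S $$ (position m z, position m w) + ?c * unit_mat m n x y $$ (position m z, position m w)"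
        using position_less[OF zw(1)] position_less[OF zw(2)] by (simp add: unit_mat_def)
      then show "restr (insert p S) $$ (position m z, position m w) =
        (restr S + ?c \<cdot>\<^sub>m unit_mat m n x y) $$ (position m z, position m w)"
        using zw xy insert.prems insert.hyps p S
        by (auto simp only: restr_index unit_mat_index split: if_split) auto
    qed (rule restr_gl)
    then have "\<rho> (restr (insert p S)) v = \<rho> (restr S) v + scale ?c (e x y v)"
      using action_add[OF restr_gl gl] action_smult[OF unit_mat_gl] by simp
    then show ?case using insert S p by (simp add: add.commute)
  qed
  then have "\<rho> (restr (labels m n \<times> labels m n)) v = (\<Sum>(x, y) \<in> labels m n \<times> labels m n.
      scale (A $$ (position m x, position m y)) (e x y v))"
    by simp
  moreover have "restr (labels m n \<times> labels m n) = A"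
    by (rule gl_carrier_eqI[OF restr_gl A]) (simp add: restr_index)
  ultimately show ?thesis by simp
qed

abbreviation e_sign :: "label \<Rightarrow> label \<Rightarrow> label \<Rightarrow> label \<Rightarrow> complex" where
  "e_sign x y z w \<equiv> super_sign (label_parity x + label_parity y) (label_parity z + label_parity w)"

text \<open>The superbracket relation of two elementary matrices, solved for the product in the
  first order. All later computations with \<open>e\<close> rest on it.\<close>

lemma e_commute:
  assumes "x \<in> labels m n" "y \<in> labels m n" "z \<in> labels m n" "w \<in> labels m n"
  shows "e x y (e z w v) = (if y = z then e x w v else 0)
    - scale (e_sign x y z w) (if w = x then e z y v else 0) + scale (e_sign x y z w) (e z w (e x y v))"
proof -
  let ?s = "e_sign x y z w" and ?O = "0\<^sub>m (m + 2 * n) (m + 2 * n) :: complex mat"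
  define P where "P = (if y = z then unit_mat m n x w else ?O)"
  define Q where "Q = (if w = x then unit_mat m n z y else ?O)"
  have PQ: "P \<in> gl_carrier m n" "Q \<in> gl_carrier m n" by (auto simp: P_def Q_def gl_carrier_def)
  have "superbracket (label_parity x + label_parity y) (label_parity z + label_parity w)
      (unit_mat m n x y) (unit_mat m n z w) = P + (- ?s) \<cdot>\<^sub>m Q"
  proof -
    have "unit_mat m n x y * unit_mat m n z w = P" "unit_mat m n z w * unit_mat m n x y = Q"
      using assms by (simp_all add: unit_mat_mult P_def Q_def)
    then show ?thesis using PQ unfolding superbracket_def gl_carrier_def by (auto intro: eq_matI)
  qed
  moreover have "(- ?s) \<cdot>\<^sub>m Q \<in> gl_carrier m n" using PQ by (simp add: gl_carrier_def)
  ultimately have "\<rho> P v + scale (- ?s) (\<rho> Q v) = e x y (e z w v) - scale ?s (e z w (e x y v))"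
    using action_superbracket[OF unit_mat_homogeneous[OF assms(1,2)] unit_mat_homogeneous[OF assms(3,4)]]
      action_add PQ action_smult by metis
  moreover have "\<rho> P v = (if y = z then e x w v else 0)" "\<rho> Q v = (if w = x then e z y v else 0)"
    by (simp_all add: P_def Q_def action_zero_mat)
  ultimately show ?thesis by (simp add: algebra_simps)
qed

lemma e_parity:
  "\<lbrakk>x \<in> labels m n; y \<in> labels m n; v \<in> V q\<rbrakk> \<Longrightarrow> e x y v \<in> V (label_parity x + label_parity y + q)"
  using action_parity unit_mat_homogeneous by blast

section \<open>Uniqueness of the highest weight\<close>

text \<open>Highest weight vectors tested on elementary matrices alone. Coordinates of
  \<open>\<mu>\<close> outside \<open>labels m n\<close> are not constrained here, so membership in
  \<open>weights m n\<close> stays a separate condition.\<close>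

definition hw_vector :: "label list \<Rightarrow> weight \<Rightarrow> 'v \<Rightarrow> bool" where
  "hw_vector xs \<mu> v \<longleftrightarrow> v \<noteq> 0 \<and>
     (\<forall>x \<in> labels m n. e x x v = scale (Poly_Mapping.lookup \<mu> x) v) \<and>
     (\<forall>x \<in> labels m n. \<forall>y \<in> labels m n. precedes xs x y \<longrightarrow> e x y v = 0)"

text \<open>The matrices \<open>unit_mat m n x x\<close> span the Cartan subalgebra, and those with
  \<open>x\<close> preceding \<open>y\<close> span the nilradical.\<close>

lemma has_highest_weight_iff:
  assumes "distinct xs"
  shows "has_highest_weight scale m n \<rho> xs \<mu> \<longleftrightarrow> \<mu> \<in> weights m n \<and> (\<exists>v. hw_vector xs \<mu> v)"
proof -
  have "(\<forall>H \<in> cartan m n. \<rho> H v = scale (eval_weight m n \<mu> H) v) \<longleftrightarrow>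
      (\<forall>x \<in> labels m n. e x x v = scale (Poly_Mapping.lookup \<mu> x) v)" for v
  proof safe
    fix x assume *: "\<forall>H \<in> cartan m n. \<rho> H v = scale (eval_weight m n \<mu> H) v" "x \<in> labels m n"
    have "unit_mat m n x x \<in> cartan m n"
      by (auto simp: cartan_def diagonal_mat_def unit_mat_def gl_carrier_def)
    moreover have "eval_weight m n \<mu> (unit_mat m n x x) = Poly_Mapping.lookup \<mu> x"
    proof -
      have "eval_weight m n \<mu> (unit_mat m n x x) =
          (\<Sum>z \<in> labels m n. if z = x then Poly_Mapping.lookup \<mu> z else 0)"
        unfolding eval_weight_def using *(2) by (intro sum.cong) (auto simp: unit_mat_index)
      then show ?thesis using *(2) by simp
    qed
    ultimately show "e x x v = scale (Poly_Mapping.lookup \<mu> x) v" using * by metis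
  next
    fix H assume *: "\<forall>x \<in> labels m n. e x x v = scale (Poly_Mapping.lookup \<mu> x) v" "H \<in> cartan m n"
    then have H: "H \<in> gl_carrier m n" and diag: "diagonal_mat H" by (auto simp: cartan_def)
    have off: "H $$ (position m x, position m y) = 0"
      if "x \<in> labels m n" "y \<in> labels m n" "x \<noteq> y" for x y
      using diag H that position_less[OF that(1)] position_less[OF that(2)]
      by (auto simp: diagonal_mat_def gl_carrier_def position_eq_iff)
    have "\<rho> H v = (\<Sum>x \<in> labels m n. \<Sum>y \<in> labels m n.
        scale (H $$ (position m x, position m y)) (e x y v))"
      by (simp add: action_expand[OF H] sum.cartesian_product)
    also have "\<dots> = (\<Sum>x \<in> labels m n. \<Sum>y \<in> labels m n.
        if y = x then scale (H $$ (position m x, position m x) * Poly_Mapping.lookup \<mu> x) v else 0)"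
      using * off by (intro sum.cong refl) auto
    also have "\<dots> = (\<Sum>x \<in> labels m n. scale (H $$ (position m x, position m x) * Poly_Mapping.lookup \<mu> x) v)"
      by (intro sum.cong refl) simp
    also have "\<dots> = scale (eval_weight m n \<mu> H) v"
      by (simp add: eval_weight_def scale_sum_left mult.commute)
    finally show "\<rho> H v = scale (eval_weight m n \<mu> H) v" .
  qed
  moreover have "(\<forall>A \<in> borel_nilradical m n xs. \<rho> A v = 0) \<longleftrightarrow>
      (\<forall>x \<in> labels m n. \<forall>y \<in> labels m n. precedes xs x y \<longrightarrow> e x y v = 0)" for v
  proof safe
    fix x y
    assume *: "\<forall>A \<in> borel_nilradical m n xs. \<rho> A v = 0" "x \<in> labels m n" "y \<in> labels m n"
      "precedes xs x y"
    \<comment> \<open>In a distinct list no entry precedes itself, so this elementary matrix has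
      zero diagonal.\<close>
    have "x \<noteq> y" using *(4) assms by (induction xs) auto
    then have "position m x \<noteq> position m y" using * by (simp add: position_eq_iff)
    then have "unit_mat m n x y \<in> borel_nilradical m n xs"
      using * by (auto simp: borel_nilradical_def borel_def unit_mat_index) (auto simp: unit_mat_def)
    then show "e x y v = 0" using * by blast
  next
    fix A
    assume *: "\<forall>x \<in> labels m n. \<forall>y \<in> labels m n. precedes xs x y \<longrightarrow> e x y v = 0"
      "A \<in> borel_nilradical m n xs"
    then have A: "A \<in> gl_carrier m n" by (auto simp: borel_nilradical_def borel_def)
    have "scale (A $$ (position m x, position m y)) (e x y v) = 0"
      if "x \<in> labels m n" "y \<in> labels m n" for x y
    proof (cases "precedes xs x y")
      case False
      then have "A $$ (position m x, position m y) = 0"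
        using *(2) that position_less[OF that(1)]
        by (cases "x = y") (auto simp: borel_nilradical_def borel_def)
      then show ?thesis by simp
    qed (use * that in simp)
    then show "\<rho> A v = 0" unfolding action_expand[OF A] by (intro sum.neutral) auto
  qed
  ultimately show ?thesis unfolding has_highest_weight_def hw_vector_def by auto
qed

text \<open>Here \<open>u = - v\<close> lies in both graded pieces, which meet only in 0.\<close>

lemma homogeneous_zero:
  assumes "u \<in> V p" "v \<in> V (p + 1)" "u + v = 0"
  shows "u = 0"
proof -
  have "u = - v" using assms(3) by (simp add: eq_neg_iff_add_eq_0)
  then have "u \<in> V (p + 1)" using assms(2) subspace_neg[OF grading_subspace] by simp
  then show ?thesis using assms(1) grading_disjoint by (cases p) auto
qed

text \<open>Elementary matrices are homogeneous, so the defining equations hold for each parity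
  component separately, and one component is nonzero. A homogeneous vector is wanted because
  irreducibility concerns graded submodules only.\<close>

lemma hw_vector_homogeneous:
  assumes "hw_vector xs \<mu> v"
  obtains q w where "w \<in> V q" "hw_vector xs \<mu> w"
proof -
  obtain v\<^sub>0 v\<^sub>1 where v: "v\<^sub>0 \<in> V 0" "v\<^sub>1 \<in> V 1" "v = v\<^sub>0 + v\<^sub>1" using grading_spans by blast
  have diag: "e x x v\<^sub>0 = scale (Poly_Mapping.lookup \<mu> x) v\<^sub>0 \<and>
      e x x v\<^sub>1 = scale (Poly_Mapping.lookup \<mu> x) v\<^sub>1" if x: "x \<in> labels m n" for x
  proof -
    let ?d = "\<lambda>w. e x x w - scale (Poly_Mapping.lookup \<mu> x) w"
    have sum: "?d v\<^sub>0 + ?d v\<^sub>1 = 0"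
      using assms x v(3) by (simp add: hw_vector_def e_add scale_right_distrib algebra_simps)
    have mem: "?d v\<^sub>0 \<in> V 0" "?d v\<^sub>1 \<in> V (0 + 1)"
      using e_parity[OF x x v(1)] e_parity[OF x x v(2)] v subspace_diff subspace_scale grading_subspace
      by auto
    have "?d v\<^sub>0 = 0" by (rule homogeneous_zero[OF mem sum])
    then show ?thesis using sum by simp
  qed
  have pos: "e x y v\<^sub>0 = 0 \<and> e x y v\<^sub>1 = 0"
    if xy: "x \<in> labels m n" "y \<in> labels m n" "precedes xs x y" for x y
  proof -
    let ?p = "label_parity x + label_parity y"
    have sum: "e x y v\<^sub>0 + e x y v\<^sub>1 = 0" using assms xy v(3) by (simp add: hw_vector_def e_add)
    have mem: "e x y v\<^sub>0 \<in> V ?p" "e x y v\<^sub>1 \<in> V (?p + 1)"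
      using e_parity[OF xy(1,2) v(1)] e_parity[OF xy(1,2) v(2)] by auto
    have "e x y v\<^sub>0 = 0" by (rule homogeneous_zero[OF mem sum])
    then show ?thesis using sum by simp
  qed
  have "v\<^sub>0 \<noteq> 0 \<or> v\<^sub>1 \<noteq> 0" using assms v(3) by (auto simp: hw_vector_def)
  then show ?thesis using that[OF v(1)] that[OF v(2)] diag pos unfolding hw_vector_def by blast
qed

text \<open>Products of lowering matrices applied to \<open>v\<close>, in any order. The number
  records the total difference of ranks, which fixes the eigenvalue under
  \<open>height_op\<close>.\<close>

inductive descendant :: "(label \<Rightarrow> nat) \<Rightarrow> 'v \<Rightarrow> nat \<Rightarrow> 'v \<Rightarrow> bool" for r v where
  descendant_refl: "descendant r v 0 v"
| descendant_step: "\<lbrakk>descendant r v k u; x \<in> labels m n; y \<in> labels m n; r y < r x\<rbrakk> \<Longrightarrow>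
    descendant r v (k + (r x - r y)) (e x y u)"

abbreviation descendants :: "(label \<Rightarrow> nat) \<Rightarrow> 'v \<Rightarrow> 'v set" where
  "descendants r v \<equiv> {u. \<exists>k. descendant r v k u}"

lemma e_span:
  assumes "\<And>u. u \<in> S \<Longrightarrow> e x y u \<in> span S'" "u \<in> span S"
  shows "e x y u \<in> span S'"
  using assms(2)
proof (induction rule: span_induct_alt)
  case base
  then show ?case by (simp add: span_zero)
next
  case (step c a b)
  then show ?case using assms(1) by (simp add: e_add e_scale span_add span_scale)
qed

text \<open>
  Moving an arbitrary elementary matrix past a lowering one costs only a bracket, a combination of
  elementary matrices applied to a shorter product; hence no ordering of the products is needed.
\<close>

lemma descendants_stable:
  assumes "inj_on r (labels m n)"
    and diag: "\<And>x. x \<in> labels m n \<Longrightarrow> e x x v = scale (Poly_Mapping.lookup \<mu> x) v"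
    and pos: "\<And>x y. x \<in> labels m n \<Longrightarrow> y \<in> labels m n \<Longrightarrow> r x < r y \<Longrightarrow> e x y v = 0"
    and "x \<in> labels m n" "y \<in> labels m n" "u \<in> span (descendants r v)"
  shows "e x y u \<in> span (descendants r v)"
proof -
  let ?U = "span (descendants r v)"
  have lower: "e z w u \<in> ?U"
    if "z \<in> labels m n" "w \<in> labels m n" "r w < r z" "u \<in> ?U" for z w u
    using that by (intro e_span[OF _ that(4)]) (auto intro!: span_base descendant_step)
  have "e x y u \<in> ?U" if "descendant r v k u" "x \<in> labels m n" "y \<in> labels m n" for k u x y
    using that
  proof (induction arbitrary: x y rule: descendant.induct)
    case descendant_refl
    have v: "v \<in> ?U" using descendant.descendant_refl by (blast intro: span_base)
    \<comment> \<open>On \<open>v\<close> itself a diagonal matrix acts by a scalar, a raising one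
      gives 0, and a lowering one gives a descendant.\<close>
    consider "x = y" | "r x < r y" | "r y < r x"
      using assms(1) descendant_refl by (metis inj_onD linorder_neqE_nat)
    then show ?case
      by cases (use descendant_refl diag pos lower v span_scale span_zero in auto)
  next
    case (descendant_step k u z w)
    have "e x w u \<in> ?U" "e z y u \<in> ?U" "e z w (e x y u) \<in> ?U"
      using descendant_step lower by auto
    then show ?case
      unfolding e_commute[OF descendant_step.prems descendant_step.hyps(2,3)]
      using span_zero by (intro span_add span_diff span_scale) auto
  qed
  then show ?thesis by (intro e_span[OF _ assms(6)]) (use assms(4,5) in blast)
qed

lemma descendant_homogeneous:
  assumes "v \<in> V q" "descendant r v k u"
  shows "u \<in> V 0 \<or> u \<in> V 1"
  using assms(2)
proof induction
  case descendant_refl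
  then show ?case using assms(1) by (cases q) auto
next
  case (descendant_step k u x y)
  obtain p where "u \<in> V p" using descendant_step.IH by blast
  then have "e x y u \<in> V (label_parity x + label_parity y + p)"
    using e_parity descendant_step.hyps by blast
  then show ?case by (metis bit_not_one_iff)
qed

text \<open>Grouping the terms of a linear combination of homogeneous vectors by parity gives its
  two components, both still in the span.\<close>

lemma span_homogeneous:
  assumes "\<And>u. u \<in> S \<Longrightarrow> u \<in> V 0 \<or> u \<in> V 1" "u \<in> span S"
  shows "\<exists>u\<^sub>0 \<in> span S \<inter> V 0. \<exists>u\<^sub>1 \<in> span S \<inter> V 1. u = u\<^sub>0 + u\<^sub>1"
  using assms(2)
proof (induction rule: span_induct_alt)
  case base
  show ?case
    by (intro bexI[of _ 0]) (auto simp: span_zero subspace_0[OF grading_subspace])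
next
  case (step c a b)
  then obtain u\<^sub>0 u\<^sub>1 where u: "u\<^sub>0 \<in> span S \<inter> V 0" "u\<^sub>1 \<in> span S \<inter> V 1" "b = u\<^sub>0 + u\<^sub>1" by blast
  have a: "scale c a \<in> span S" using step by (simp add: span_base span_scale)
  have sub: "w + scale c a \<in> V p" if "w \<in> V p" "a \<in> V p" for w p
    using that subspace_add subspace_scale grading_subspace by blast
  show ?case
  proof (cases "a \<in> V 0")
    case True
    have "scale c a + b = (u\<^sub>0 + scale c a) + u\<^sub>1" by (simp add: u)
    then show ?thesis using u a sub True by (meson IntD1 IntD2 IntI span_add)
  next
    case False
    then have "a \<in> V 1" using assms(1) step by blast
    moreover have "scale c a + b = u\<^sub>0 + (u\<^sub>1 + scale c a)" by (simp add: u)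
    ultimately show ?thesis using u a sub by (meson IntD1 IntD2 IntI span_add)
  qed
qed

lemma action_stableI:
  assumes "subspace U" "\<And>x y u. x \<in> labels m n \<Longrightarrow> y \<in> labels m n \<Longrightarrow> u \<in> U \<Longrightarrow> e x y u \<in> U"
    and "A \<in> gl_carrier m n" "u \<in> U"
  shows "\<rho> A u \<in> U"
  unfolding action_expand[OF assms(3)]
  using assms by (intro subspace_sum) (auto intro: subspace_scale)

text \<open>Applying \<open>T - a j\<close> removes the term with index \<open>j\<close>, rescales
  the other terms and multiplies \<open>w\<close> by \<open>c - a j\<close>, which is nonzero.
  Induction on \<open>K\<close> then gives \<open>w = 0\<close>.\<close>

lemma eigenvector_sum_zero:
  assumes "Vector_Spaces.linear scale scale T" "finite K"
    and "\<And>k. k \<in> K \<Longrightarrow> T (u k) = scale (a k) (u k) \<and> a k \<noteq> c"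
    and "T w = scale c w" "w = (\<Sum>k\<in>K. u k)"
  shows "w = 0"
  using assms(2-)
proof (induction K arbitrary: u w rule: finite_induct)
  case empty
  then show ?case by simp
next
  case (insert j K)
  interpret T: Vector_Spaces.linear scale scale T by (rule assms(1))
  let ?w = "scale (c - a j) w"
  have "T w - scale (a j) w = (\<Sum>k\<in>insert j K. T (u k) - scale (a j) (u k))"
    unfolding insert.prems(3) by (simp only: T.sum scale_sum_right sum_subtractf)
  also have "\<dots> = (\<Sum>k\<in>K. scale (a k - a j) (u k))"
    using insert by (simp add: scale_left_diff_distrib)
  finally have sum: "?w = (\<Sum>k\<in>K. scale (a k - a j) (u k))"
    using insert.prems(2) by (simp add: scale_left_diff_distrib)
  have "?w = 0"
  proof (rule insert.IH[OF _ _ sum])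
    show "T ?w = scale c ?w" using insert.prems(2) by (simp add: T.scale mult.commute)
    show "T (scale (a k - a j) (u k)) = scale (a k) (scale (a k - a j) (u k)) \<and> a k \<noteq> c"
      if "k \<in> K" for k
      using insert.prems(1)[of k] that by (simp add: T.scale mult.commute)
  qed
  then show ?case using insert.prems(1)[of j] by auto
qed

text \<open>In a linear combination equal to \<open>w\<close>, let \<open>w'\<close> collect the
  terms with eigenvalue \<open>c\<close>. The difference \<open>w - w'\<close> is again scaled by
  \<open>c\<close> but is a sum of eigenvectors for other eigenvalues, hence 0.\<close>

lemma eigenvector_in_span:
  assumes "Vector_Spaces.linear scale scale T"
    and G: "\<And>g. g \<in> G \<Longrightarrow> \<exists>a. T g = scale a g"
    and "T w = scale c w" "w \<in> span G"
  shows "w \<in> span {g \<in> G. T g = scale c g}"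
proof -
  interpret T: Vector_Spaces.linear scale scale T by (rule assms(1))
  obtain K q where K: "finite K" "K \<subseteq> G" "w = (\<Sum>g\<in>K. scale (q g) g)"
    using assms(4) by (auto simp: span_explicit)
  obtain a where a: "\<And>g. g \<in> G \<Longrightarrow> T g = scale (a g) g" using G by metis
  define w' where "w' = (\<Sum>g\<in>{g \<in> K. a g = c}. scale (q g) g)"
  have "K = {g \<in> K. a g = c} \<union> {g \<in> K. a g \<noteq> c}" by auto
  then have "w = w' + (\<Sum>g\<in>{g \<in> K. a g \<noteq> c}. scale (q g) g)"
    unfolding w'_def K(3) using K(1) by (subst sum.union_disjoint[symmetric]) auto
  then have "w - w' = (\<Sum>g\<in>{g \<in> K. a g \<noteq> c}. scale (q g) g)" by simp
  moreover have "T w' = scale c w'"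
    unfolding w'_def T.sum scale_sum_right using K(2) a
    by (intro sum.cong refl) (auto simp: T.scale mult.commute)
  then have "T (w - w') = scale c (w - w')" using assms(3) by (simp add: T.diff scale_right_diff_distrib)
  ultimately have "w - w' = 0"
    using K a by (intro eigenvector_sum_zero[OF assms(1), where K = "{g \<in> K. a g \<noteq> c}"])
      (auto simp: T.scale mult.commute subsetD)
  moreover have "w' \<in> span {g \<in> G. T g = scale c g}"
    unfolding w'_def using K(2) a by (intro span_sum span_scale span_base) auto
  ultimately show ?thesis by simp
qed

text \<open>The action of the diagonal matrix with entry \<open>r x\<close> at the position of
  \<open>x\<close>. Every lowering matrix increases its eigenvalue by a positive integer.\<close>

definition height_op :: "(label \<Rightarrow> nat) \<Rightarrow> 'v \<Rightarrow> 'v" where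
  "height_op r u = (\<Sum>x \<in> labels m n. scale (of_nat (r x)) (e x x u))"

lemma height_op_linear: "Vector_Spaces.linear scale scale (height_op r)"
proof (unfold_locales)
  show "height_op r (u + v) = height_op r u + height_op r v" for u v
    by (simp add: height_op_def e_add scale_right_distrib sum.distrib)
  show "height_op r (scale c u) = scale c (height_op r u)" for c u
    by (simp add: height_op_def e_scale scale_sum_right mult.commute)
qed

text \<open>An elementary matrix is an eigenvector of the diagonal matrix under the bracket, with
  eigenvalue \<open>r z - r w\<close>. No sign appears because diagonal matrices are even.\<close>

lemma height_op_e:
  assumes "z \<in> labels m n" "w \<in> labels m n"
  shows "height_op r (e z w u) =
    scale (of_nat (r z) - of_nat (r w)) (e z w u) + e z w (height_op r u)"
proof -
  have "scale (of_nat (r x)) (e x x (e z w u)) =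
      (if x = z then scale (of_nat (r z)) (e z w u) else 0)
      - (if x = w then scale (of_nat (r w)) (e z w u) else 0)
      + e z w (scale (of_nat (r x)) (e x x u))" if "x \<in> labels m n" for x
    unfolding e_commute[OF that that assms]
    by (auto simp: super_sign_def e_scale algebra_simps)
  then have "height_op r (e z w u) =
      (\<Sum>x \<in> labels m n. if x = z then scale (of_nat (r z)) (e z w u) else 0)
      - (\<Sum>x \<in> labels m n. if x = w then scale (of_nat (r w)) (e z w u) else 0)
      + e z w (height_op r u)"
    unfolding height_op_def e_sum by (simp add: sum.distrib sum_subtractf)
  then show ?thesis using assms by (simp add: scale_left_diff_distrib)
qed

lemma descendant_height:
  assumes "descendant r v k u" "height_op r v = scale c v"
  shows "height_op r u = scale (c + of_nat k) u"
  using assms(1)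
proof induction
  case descendant_refl
  then show ?case using assms(2) by simp
next
  case (descendant_step k u x y)
  then show ?case
    by (simp add: height_op_e e_scale of_nat_diff flip: scale_left_distrib)
qed

text \<open>Each lowering step adds \<open>r x - r y > 0\<close>, so level 0 allows no step.\<close>

lemma descendant_0:
  assumes "descendant r v k u" "k = 0"
  shows "u = v"
  using assms by (induction) auto

end

section \<open>Interchanging adjacent entries, and the form on odd roots\<close>

lemma precedes_swap:
  assumes "distinct (as @ x # y # bs)"
  shows "precedes (as @ y # x # bs) a b \<longleftrightarrow>
    a = y \<and> b = x \<or> precedes (as @ x # y # bs) a b \<and> \<not> (a = x \<and> b = y)"
  using assms by (auto dest: precedes_in_set)

lemma reflect_adjacent:
  assumes "distinct (as @ x # y # bs)"
  shows "reflect (x, y) (as @ x # y # bs) = as @ y # x # bs"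
  using assms unfolding reflect_def by (auto simp: transpose_def intro!: map_idI)

lemma lookup_root:
  "Poly_Mapping.lookup (root (x, y)) z = (if z = x then 1 else 0) - (if z = y then 1 else 0)"
  by (auto simp: root_def lookup_minus lookup_single when_def)

lemma root_in_weights: "x \<in> labels m n \<Longrightarrow> y \<in> labels m n \<Longrightarrow> root (x, y) \<in> weights m n"
  by (auto simp: weights_def lookup_root in_keys_iff split: if_splits)

lemma weights_diff: "\<mu> \<in> weights m n \<Longrightarrow> \<nu> \<in> weights m n \<Longrightarrow> \<mu> - \<nu> \<in> weights m n"
  using keys_diff[of \<mu> \<nu>] by (auto simp: weights_def)

text \<open>The minus sign comes from the form at \<open>Del k\<close> and from the coefficient of
  the root at \<open>Eps i\<close>, so both coordinates get the same sign.\<close>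

lemma weight_form_odd_root:
  assumes "Del k \<in> labels m n" "Eps i \<in> labels m n"
  shows "weight_form m n \<mu> (root (Del k, Eps i)) =
    - (Poly_Mapping.lookup \<mu> (Del k) + Poly_Mapping.lookup \<mu> (Eps i))"
proof -
  have "(\<Sum>i' = 1..m. Poly_Mapping.lookup \<mu> (Eps i') * Poly_Mapping.lookup (root (Del k, Eps i)) (Eps i')) =
      (\<Sum>i' = 1..m. if i' = i then - Poly_Mapping.lookup \<mu> (Eps i') else 0)"
    by (intro sum.cong) (auto simp: lookup_root)
  also have "\<dots> = - Poly_Mapping.lookup \<mu> (Eps i)" using assms(2) by (auto simp: labels_def)
  finally have "(\<Sum>i' = 1..m. Poly_Mapping.lookup \<mu> (Eps i') *
      Poly_Mapping.lookup (root (Del k, Eps i)) (Eps i')) = - Poly_Mapping.lookup \<mu> (Eps i)" .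
  moreover have "(\<Sum>j = 1..2 * n. Poly_Mapping.lookup \<mu> (Del j) * Poly_Mapping.lookup (root (Del k, Eps i)) (Del j)) =
      (\<Sum>j = 1..2 * n. if j = k then Poly_Mapping.lookup \<mu> (Del j) else 0)"
    by (intro sum.cong) (auto simp: lookup_root)
  moreover have "\<dots> = Poly_Mapping.lookup \<mu> (Del k)" using assms(1) by (auto simp: labels_def)
  ultimately show ?thesis unfolding weight_form_def by simp
qed

text \<open>With the pair as the argument before the weight, the rule can be iterated by
  \<open>fold\<close> along a list of reflections.\<close>

definition reflected_weight :: "nat \<Rightarrow> nat \<Rightarrow> label \<times> label \<Rightarrow> weight \<Rightarrow> weight" where
  "reflected_weight m n p \<mu> = (if weight_form m n \<mu> (root p) \<noteq> 0 then \<mu> - root p else \<mu>)"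

context gl_supermodule
begin

lemma hw_vector_height:
  assumes "hw_vector xs \<mu> v"
  shows "height_op r v = scale (\<Sum>x \<in> labels m n. of_nat (r x) * Poly_Mapping.lookup \<mu> x) v"
  using assms by (simp add: height_op_def hw_vector_def scale_sum_left)

end

context irreducible_fd_gl_supermodule
begin

text \<open>The span is stable under the action, graded because \<open>v\<close> is homogeneous, and
  contains \<open>v \<noteq> 0\<close>; irreducibility does the rest.\<close>

lemma descendants_span:
  assumes "hw_vector xs \<mu> v" "v \<in> V q" "inj_on r (labels m n)"
    and r: "\<And>x y. x \<in> labels m n \<Longrightarrow> y \<in> labels m n \<Longrightarrow> precedes xs x y \<longleftrightarrow> r x < r y"
  shows "span (descendants r v) = UNIV"
proof -
  let ?U = "span (descendants r v)"
  have stable: "e x y u \<in> ?U" if "x \<in> labels m n" "y \<in> labels m n" "u \<in> ?U" for x y u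
    using assms(1) r by (intro descendants_stable[OF assms(3) _ _ that]) (auto simp: hw_vector_def)
  have "subsupermodule ?U"
    unfolding subsupermodule_def
  proof (intro conjI ballI)
    show "\<exists>u\<^sub>0 \<in> ?U \<inter> V 0. \<exists>u\<^sub>1 \<in> ?U \<inter> V 1. u = u\<^sub>0 + u\<^sub>1" if "u \<in> ?U" for u
      using descendant_homogeneous[OF assms(2)] that by (intro span_homogeneous) auto
    show "\<rho> A u \<in> ?U" if "A \<in> gl_carrier m n" "u \<in> ?U" for A u
      by (rule action_stableI[OF subspace_span stable that])
  qed simp
  moreover have "v \<in> ?U" using descendant_refl by (blast intro: span_base)
  moreover have "v \<noteq> 0" using assms(1) by (simp add: hw_vector_def)
  ultimately show ?thesis using irreducible by blast
qed

text \<open>The module is spanned by descendants, whose eigenvalues are \<open>c + of_nat k\<close>.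
  Hence \<open>w\<close> is a combination of descendants with its own eigenvalue, and only
  \<open>v\<close> itself has level 0.\<close>

lemma height_eigenvalue_shift:
  assumes "hw_vector xs \<mu> v" "v \<in> V q" "inj_on r (labels m n)"
    and r: "\<And>x y. x \<in> labels m n \<Longrightarrow> y \<in> labels m n \<Longrightarrow> precedes xs x y \<longleftrightarrow> r x < r y"
    and c: "height_op r v = scale c v" and w: "w \<noteq> 0" "height_op r w = scale c' w"
  obtains k :: nat where "c' = c + of_nat k" "k = 0 \<Longrightarrow> w \<in> span {v}"
proof -
  let ?G = "{g \<in> descendants r v. height_op r g = scale c' g}"
  have "w \<in> span (descendants r v)" using descendants_span[OF assms(1-4)] by simp
  then have wG: "w \<in> span ?G"
    using w descendant_height[OF _ c] by (intro eigenvector_in_span[OF height_op_linear]) auto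
  have shift: "c' = c + of_nat k" if "g \<noteq> 0" "height_op r g = scale c' g" "descendant r v k g" for g k
    using descendant_height[OF that(3) c] that by simp
  \<comment> \<open>Otherwise \<open>w\<close> would lie in the span of 0.\<close>
  have "\<not> ?G \<subseteq> {0}" using wG w(1) span_mono[of ?G "{0}"] by auto
  then obtain g k where g: "g \<noteq> 0" "height_op r g = scale c' g" "descendant r v k g" by blast
  show ?thesis
  proof (rule that[OF shift[OF g]])
    assume "k = 0"
    then have "c' = c" using shift[OF g] by simp
    \<comment> \<open>A nonzero element of \<open>?G\<close> now has level 0, hence equals
      \<open>v\<close>; the zero vector lies in any span.\<close>
    then have "?G \<subseteq> span {v}"
      using shift descendant_0 span_zero span_base by (auto, metis add_cancel_left_right insertI1 of_nat_eq_0_iff)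
    then show "w \<in> span {v}" using wG span_minimal[OF _ subspace_span] by blast
  qed
qed

text \<open>
  Each highest weight vector generates the module by lowering operators, so neither can lie strictly
  below the other with respect to \<open>height_op\<close>; being of the same height they are proportional.
\<close>

lemma highest_weight_unique:
  assumes "xs \<in> borel_sequences m n"
    and "has_highest_weight scale m n \<rho> xs \<mu>" "has_highest_weight scale m n \<rho> xs \<nu>"
  shows "\<mu> = \<nu>"
proof -
  have xs: "distinct xs" "set xs = labels m n" using assms(1) by (auto simp: borel_sequences_def)
  obtain r :: "label \<Rightarrow> nat" where r: "inj_on r (labels m n)"
    "\<And>x y. x \<in> labels m n \<Longrightarrow> y \<in> labels m n \<Longrightarrow> precedes xs x y \<longleftrightarrow> r x < r y"
    by (rule precedes_rank[OF xs(1), unfolded xs(2)]) (rule that, simp_all)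
  obtain v w p q where v: "v \<in> V p" "hw_vector xs \<mu> v" and w: "w \<in> V q" "hw_vector xs \<nu> w"
    using assms(2,3) hw_vector_homogeneous unfolding has_highest_weight_iff[OF xs(1)] by metis
  have nz: "v \<noteq> 0" "w \<noteq> 0" using v w by (auto simp: hw_vector_def)
  note cv = hw_vector_height[OF v(2), of r] and cw = hw_vector_height[OF w(2), of r]
  obtain k where k: "(\<Sum>x \<in> labels m n. of_nat (r x) * Poly_Mapping.lookup \<nu> x) =
      (\<Sum>x \<in> labels m n. of_nat (r x) * Poly_Mapping.lookup \<mu> x) + of_nat k"
    "k = 0 \<Longrightarrow> w \<in> span {v}"
    using height_eigenvalue_shift[OF v(2,1) r cv nz(2) cw] by blast
  obtain k' where k': "(\<Sum>x \<in> labels m n. of_nat (r x) * Poly_Mapping.lookup \<mu> x) =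
      (\<Sum>x \<in> labels m n. of_nat (r x) * Poly_Mapping.lookup \<nu> x) + of_nat k'"
    using height_eigenvalue_shift[OF w(2,1) r cw nz(1) cv] by blast
  have "of_nat (k + k') = (0 :: complex)" using k(1) k' by (simp add: add.commute)
  then have "k = 0" by (simp only: of_nat_eq_0_iff add_is_0)
  then obtain a where a: "w = scale a v" using k(2) by (auto simp: span_singleton)
  show ?thesis
  proof (rule poly_mapping_eqI)
    fix x
    show "Poly_Mapping.lookup \<mu> x = Poly_Mapping.lookup \<nu> x"
    proof (cases "x \<in> labels m n")
      case True
      then have "e x x v = scale (Poly_Mapping.lookup \<mu> x) v" "e x x w = scale (Poly_Mapping.lookup \<nu> x) w"
        using v w by (auto simp: hw_vector_def)
      then show ?thesis using a nz by (simp add: e_scale)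
    next
      case False
      then have "x \<notin> Poly_Mapping.keys \<mu>" "x \<notin> Poly_Mapping.keys \<nu>"
        using assms(2,3) by (auto simp: has_highest_weight_def weights_def)
      then show ?thesis by (simp add: in_keys_iff)
    qed
  qed
qed

lemma highest_weight_eqI:
  assumes "xs \<in> borel_sequences m n" "has_highest_weight scale m n \<rho> xs \<mu>"
  shows "highest_weight scale m n \<rho> xs = \<mu>"
  unfolding highest_weight_def using assms highest_weight_unique by (intro the_equality)

section \<open>Odd reflections\<close>

text \<open>Because \<open>x\<close> and \<open>y\<close> are adjacent, the bracket of
  \<open>e y x\<close> with any other raising matrix of the reflected sequence is 0 or, up to sign,
  a raising matrix of \<open>xs\<close>, which kills \<open>v\<close>.\<close>

lemma hw_vector_odd_lowering:
  assumes xs: "xs = as @ x # y # bs" "xs \<in> borel_sequences m n"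
    and odd: "label_parity x + label_parity y = 1"
    and v: "hw_vector xs \<mu> v"
  shows "z \<in> labels m n \<Longrightarrow> e z z (e y x v) = scale (Poly_Mapping.lookup (\<mu> - root (x, y)) z) (e y x v)"
    and "\<lbrakk>z \<in> labels m n; w \<in> labels m n; precedes (as @ y # x # bs) z w\<rbrakk> \<Longrightarrow> e z w (e y x v) = 0"
    and "e x y (e y x v) = scale (Poly_Mapping.lookup \<mu> x + Poly_Mapping.lookup \<mu> y) v"
proof -
  have dist: "distinct xs" and set: "set xs = labels m n" using xs by (auto simp: borel_sequences_def)
  have xy: "x \<in> labels m n" "y \<in> labels m n" "x \<noteq> y" using xs dist set by auto
  have diag: "e z z v = scale (Poly_Mapping.lookup \<mu> z) v" if "z \<in> labels m n" for z
    using v that by (auto simp: hw_vector_def)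
  have pos: "e z w v = 0" if "precedes xs z w" for z w
    using v that precedes_in_set[OF that] set by (auto simp: hw_vector_def)
  have odd': "label_parity y + label_parity x = 1" using odd by (simp add: add.commute)
  show "e z z (e y x v) = scale (Poly_Mapping.lookup (\<mu> - root (x, y)) z) (e y x v)"
    if "z \<in> labels m n"
    using xy that unfolding e_commute[OF that that xy(2,1)]
    by (auto simp: diag e_scale super_sign_def lookup_minus lookup_root scale_left_diff_distrib
        scale_left_distrib)
  have "precedes xs x y" by (simp add: xs)
  then have "e x y v = 0" by (rule pos)
  then show "e x y (e y x v) = scale (Poly_Mapping.lookup \<mu> x + Poly_Mapping.lookup \<mu> y) v"
    unfolding e_commute[OF xy(1,2,2,1)] using xy odd odd'
    by (simp add: super_sign_def diag scale_left_distrib)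
  show "e z w (e y x v) = 0"
    if zw: "z \<in> labels m n" "w \<in> labels m n" "precedes (as @ y # x # bs) z w"
  proof (cases "z = y \<and> w = x")
    case True
    \<comment> \<open>The superbracket of the odd matrix with itself is zero and equals twice its
      square.\<close>
    have "e y x (e y x v) = - e y x (e y x v)"
      using e_commute[OF xy(2,1,2,1), of v] xy(3) odd' by (simp add: super_sign_def)
    then have "scale 2 (e y x (e y x v)) = 0"
      using scale_left_distrib[of 1 1 "e y x (e y x v)"] by (simp add: eq_neg_iff_add_eq_0)
    then show ?thesis using True by simp
  next
    case False
    then have old: "precedes xs z w" and ne: "\<not> (z = x \<and> w = y)"
      using zw(3) dist unfolding xs(1) precedes_swap[OF dist[unfolded xs(1)]] by auto
    \<comment> \<open>By adjacency, what precedes \<open>y\<close> and differs from \<open>x\<close>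
      precedes \<open>x\<close>; dually, what follows \<open>x\<close> and differs from
      \<open>y\<close> follows \<open>y\<close>.\<close>
    have "precedes xs z x" if "w = y" using old that ne dist unfolding xs(1)
      by (auto dest: precedes_in_set)
    moreover have "precedes xs y w" if "z = x" using old that ne dist unfolding xs(1)
      by (auto dest: precedes_in_set)
    ultimately show ?thesis
      unfolding e_commute[OF zw(1,2) xy(2,1)] using pos[OF old] pos ne
      by (cases "z = x"; cases "w = y") simp_all
  qed
qed

lemma odd_reflection:
  assumes xs: "xs = as @ Del k # Eps i # bs" "xs \<in> borel_sequences m n"
    and hw: "has_highest_weight scale m n \<rho> xs \<mu>"
  shows "has_highest_weight scale m n \<rho> (as @ Eps i # Del k # bs)
    (reflected_weight m n (Del k, Eps i) \<mu>)"
proof -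
  let ?ys = "as @ Eps i # Del k # bs" and ?p = "(Del k, Eps i)"
  have dist: "distinct xs" and set: "set xs = labels m n" using xs by (auto simp: borel_sequences_def)
  have dist': "distinct ?ys" using dist xs(1) by auto
  have lab: "Del k \<in> labels m n" "Eps i \<in> labels m n" using xs(1) set by auto
  obtain v where v: "hw_vector xs \<mu> v" and \<mu>: "\<mu> \<in> weights m n"
    using hw has_highest_weight_iff[OF dist] by blast
  have \<mu>': "\<mu> - root ?p \<in> weights m n" using \<mu> lab root_in_weights weights_diff by blast
  let ?w = "e (Eps i) (Del k) v"
  have "label_parity (Del k) + label_parity (Eps i) = 1" by simp
  note lowering = hw_vector_odd_lowering[OF xs this v]
  have form: "e (Del k) (Eps i) ?w = scale (- weight_form m n \<mu> (root ?p)) v"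
    unfolding weight_form_odd_root[OF lab] using lowering(3) by simp
  show ?thesis
  proof (cases "weight_form m n \<mu> (root ?p) = 0")
    case False
    \<comment> \<open>Raising \<open>?w\<close> back gives a nonzero multiple of
      \<open>v\<close>.\<close>
    then have "?w \<noteq> 0" using form v by (auto simp: hw_vector_def)
    then have "hw_vector ?ys (\<mu> - root ?p) ?w"
      unfolding hw_vector_def by (intro conjI ballI impI lowering(1,2))
    then show ?thesis
      unfolding has_highest_weight_iff[OF dist'] using False \<mu>' by (auto simp: reflected_weight_def)
  next
    case True
    have "?w = 0"
    proof (rule ccontr)
      assume "?w \<noteq> 0"
      \<comment> \<open>The positive roots of \<open>xs\<close> other than \<open>root ?p\<close>
        stay positive after the reflection; the root vector of \<open>root ?p\<close> kills
        \<open>?w\<close> because the form vanishes.\<close>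
      moreover have kill: "e z w ?w = 0"
        if "z \<in> labels m n" "w \<in> labels m n" "precedes xs z w" for z w
        using that form True lowering(2)[OF that(1,2)] precedes_swap[OF dist[unfolded xs(1)], of z w]
        unfolding xs(1) by auto
      ultimately have "hw_vector xs (\<mu> - root ?p) ?w"
        unfolding hw_vector_def by (intro conjI ballI impI lowering(1) kill)
      then have "has_highest_weight scale m n \<rho> xs (\<mu> - root ?p)"
        unfolding has_highest_weight_iff[OF dist] using \<mu>' by blast
      then have "\<mu> - root ?p = \<mu>" by (rule highest_weight_unique[OF xs(2) _ hw])
      then have "Poly_Mapping.lookup (root ?p) (Del k) = 0" by simp
      then show False by (simp add: lookup_root)
    qed
    \<comment> \<open>The only new condition on \<open>v\<close> for the reflected sequence is
      \<open>?w = 0\<close>.\<close>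
    then have "hw_vector ?ys \<mu> v"
      using v unfolding hw_vector_def precedes_swap[OF dist[unfolded xs(1)]] xs(1) by blast
    then show ?thesis
      unfolding has_highest_weight_iff[OF dist'] using True \<mu> by (auto simp: reflected_weight_def)
  qed
qed

end

section \<open>Decreasing sequences and the reflections leading to them\<close>

text \<open>Shuffles of two descending runs, \<open>l\<close> entries \<open>Del\<close> and
  \<open>i\<close> entries \<open>Eps\<close>. Reading from the left suits the induction that
  constructs the reflections.\<close>

inductive decreasing_list :: "nat \<Rightarrow> nat \<Rightarrow> label list \<Rightarrow> bool" where
  "decreasing_list 0 0 []"
| "decreasing_list l i xs \<Longrightarrow> decreasing_list (Suc l) i (Del (Suc l) # xs)"
| "decreasing_list l i xs \<Longrightarrow> decreasing_list l (Suc i) (Eps (Suc i) # xs)"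

lemma decreasing_list_set:
  "decreasing_list l i xs \<Longrightarrow> set xs = Eps ` {1..i} \<union> Del ` {1..l}"
  by (induction rule: decreasing_list.induct) (auto simp: atLeastAtMostSuc_conv)

text \<open>The head has the largest index of its kind: otherwise that largest label would come
  after a smaller one.\<close>

lemma decreasing_listI:
  assumes "distinct xs" "set xs = Eps ` {1..i} \<union> Del ` {1..l}"
    and "\<And>a b. precedes xs (Eps a) (Eps b) \<Longrightarrow> b < a"
    and "\<And>a b. precedes xs (Del a) (Del b) \<Longrightarrow> b < a"
  shows "decreasing_list l i xs"
  using assms
proof (induction xs arbitrary: l i)
  case Nil
  then have "{1..i} = {}" "{1..l} = {}" by auto
  then have "i = 0" "l = 0" by auto
  then show ?case by (simp add: decreasing_list.intros)
next
  case (Cons x xs)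
  have rest: "set xs = (Eps ` {1..i} \<union> Del ` {1..l}) - {x}" using Cons.prems(1,2) by auto
  show ?case
  proof (cases x)
    case (Eps a)
    then have "Eps a \<in> Eps ` {1..i} \<union> Del ` {1..l}" using Cons.prems(2) by (metis list.set_intros(1))
    then have a: "1 \<le> a" "a \<le> i" by auto
    have "a = i"
    proof (rule ccontr)
      assume "a \<noteq> i"
      then have "Eps i \<in> set xs" using rest Eps a by auto
      then have "i < a" using Cons.prems(3) Eps by auto
      then show False using a by simp
    qed
    then obtain i' where i: "i = Suc i'" "x = Eps (Suc i')" using a Eps by (cases i) auto
    have "decreasing_list l i' xs"
    proof (rule Cons.IH)
      show "set xs = Eps ` {1..i'} \<union> Del ` {1..l}"
        unfolding rest i by (auto simp: atLeastAtMostSuc_conv)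
    qed (use Cons.prems in auto)
    then show ?thesis unfolding i by (rule decreasing_list.intros)
  next
    case (Del a)
    then have "Del a \<in> Eps ` {1..i} \<union> Del ` {1..l}" using Cons.prems(2) by (metis list.set_intros(1))
    then have a: "1 \<le> a" "a \<le> l" by auto
    have "a = l"
    proof (rule ccontr)
      assume "a \<noteq> l"
      then have "Del l \<in> set xs" using rest Del a by auto
      then have "l < a" using Cons.prems(4) Del by auto
      then show False using a by simp
    qed
    then obtain l' where l: "l = Suc l'" "x = Del (Suc l')" using a Del by (cases l) auto
    have "decreasing_list l' i xs"
    proof (rule Cons.IH)
      show "set xs = Eps ` {1..i} \<union> Del ` {1..l'}"
        unfolding rest l by (auto simp: atLeastAtMostSuc_conv)
    qed (use Cons.prems in auto)
    then show ?thesis unfolding l by (rule decreasing_list.intros)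
  qed
qed

lemma decreasing_borels_list: "xs \<in> decreasing_borels m n \<Longrightarrow> decreasing_list (2 * n) m xs"
  by (rule decreasing_listI) (auto simp: decreasing_borels_def borel_sequences_def labels_def)

section \<open>The list of reflections as a path of simple odd roots\<close>

lemma reflection_roots_0 [simp]: "reflection_roots 0 xs = []"
  by (simp add: reflection_roots_def)

lemma reflection_roots_Suc:
  "reflection_roots (Suc i) xs =
    map (\<lambda>k. (Del k, Eps (Suc i))) [1..<Suc (dels_right xs (Suc i))] @ reflection_roots i xs"
  by (simp add: reflection_roots_def)

lemma reflection_roots_cong:
  assumes "\<And>j. 1 \<le> j \<Longrightarrow> j \<le> i \<Longrightarrow> dels_right xs j = dels_right ys j"
  shows "reflection_roots i xs = reflection_roots i ys"
  using assms by (induction i) (auto simp: reflection_roots_Suc simp del: upt_Suc)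

text \<open>A leading \<open>Del\<close> is to the right of no \<open>Eps\<close>.\<close>

lemma reflection_roots_Del: "reflection_roots i (Del l # xs) = reflection_roots i xs"
  by (rule reflection_roots_cong) (simp add: dels_right_def)

text \<open>All \<open>l\<close> labels \<open>Del\<close> stand to the right of the leading
  \<open>Eps\<close>, and the counts for the other \<open>Eps\<close> do not change.\<close>

lemma reflection_roots_Eps:
  assumes "decreasing_list l i xs"
  shows "reflection_roots (Suc i) (Eps (Suc i) # xs) =
    map (\<lambda>k. (Del k, Eps (Suc i))) [1..<Suc l] @ reflection_roots i xs"
proof -
  have "{k. precedes (Eps (Suc i) # xs) (Eps (Suc i)) (Del k)} = {1..l}"
    using decreasing_list_set[OF assms] by (auto dest: precedes_in_set)
  then have "dels_right (Eps (Suc i) # xs) (Suc i) = l" by (simp add: dels_right_def)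
  moreover have "reflection_roots i (Eps (Suc i) # xs) = reflection_roots i xs"
    by (rule reflection_roots_cong) (simp add: dels_right_def)
  ultimately show ?thesis by (simp add: reflection_roots_Suc)
qed

text \<open>Expresses that each pair is a simple root of the sequence reached so far, so that every
  reflection in the list is a genuine odd reflection.\<close>

fun odd_path :: "label list \<Rightarrow> (label \<times> label) list \<Rightarrow> bool" where
  "odd_path xs [] \<longleftrightarrow> True"
| "odd_path xs (p # ps) \<longleftrightarrow>
    (\<exists>as k i bs. p = (Del k, Eps i) \<and> xs = as @ Del k # Eps i # bs) \<and> odd_path (reflect p xs) ps"

lemma odd_path_append:
  "odd_path xs (ps @ qs) \<longleftrightarrow> odd_path xs ps \<and> odd_path (fold reflect ps xs) qs"
  by (induction ps arbitrary: xs) auto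

abbreviation dels_desc :: "nat \<Rightarrow> label list" where
  "dels_desc l \<equiv> map Del (rev [1..<Suc l])"

abbreviation epss_desc :: "nat \<Rightarrow> label list" where
  "epss_desc i \<equiv> map Eps (rev [1..<Suc i])"

text \<open>The label \<open>Eps i\<close> moves left past \<open>Del 1\<close>,
  \<open>Del 2\<close> and so on. The prefix \<open>as\<close> is arbitrary so that it can absorb
  the \<open>Del\<close> that is passed last.\<close>

lemma odd_path_pass_dels:
  assumes "distinct (as @ dels_desc l @ Eps i # bs)"
  defines "ps \<equiv> map (\<lambda>k. (Del k, Eps i)) [1..<Suc l]"
  shows "odd_path (as @ dels_desc l @ Eps i # bs) ps \<and>
    fold reflect ps (as @ dels_desc l @ Eps i # bs) = as @ Eps i # dels_desc l @ bs"
  using assms(1) unfolding ps_def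
proof (induction l arbitrary: as)
  case 0
  then show ?case by simp
next
  case (Suc l)
  let ?ps = "map (\<lambda>k. (Del k, Eps i)) [1..<Suc l]"
  let ?xs = "(as @ [Del (Suc l)]) @ dels_desc l @ Eps i # bs"
  have eq: "as @ dels_desc (Suc l) @ Eps i # bs = ?xs" by simp
  have path: "odd_path ?xs ?ps"
    "fold reflect ?ps ?xs = as @ Del (Suc l) # Eps i # dels_desc l @ bs"
    using Suc.IH[of "as @ [Del (Suc l)]"] Suc.prems unfolding eq by (simp_all del: upt_Suc)
  have dist: "distinct (as @ Del (Suc l) # Eps i # dels_desc l @ bs)"
    using Suc.prems unfolding eq by (auto simp del: upt_Suc)
  have "odd_path ?xs (?ps @ [(Del (Suc l), Eps i)])"
    unfolding odd_path_append path(2) using path(1) by auto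
  moreover have "fold reflect (?ps @ [(Del (Suc l), Eps i)]) ?xs =
      as @ Eps i # Del (Suc l) # dels_desc l @ bs"
    using path(2) reflect_adjacent[OF dist] by (simp del: upt_Suc)
  ultimately show ?case unfolding eq by simp
qed

text \<open>A leading \<open>Del\<close> of the target is already in place and joins the prefix. A
  leading \<open>Eps\<close> is first moved to the front past all remaining \<open>Del\<close>; the
  other reflections act behind it.\<close>

lemma odd_path_reflection_roots:
  assumes "decreasing_list l i ys" "distinct (as @ dels_desc l @ epss_desc i)"
  shows "odd_path (as @ dels_desc l @ epss_desc i) (reflection_roots i ys) \<and>
    fold reflect (reflection_roots i ys) (as @ dels_desc l @ epss_desc i) = as @ ys"
  using assms
proof (induction arbitrary: as rule: decreasing_list.induct)
  case 1
  then show ?case by simp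
next
  case (2 l i ys)
  have "as @ dels_desc (Suc l) @ epss_desc i = (as @ [Del (Suc l)]) @ dels_desc l @ epss_desc i"
    by simp
  then show ?case using 2(2)[of "as @ [Del (Suc l)]"] 2(3) by (simp add: reflection_roots_Del del: upt_Suc)
next
  case (3 l i ys)
  let ?ps = "map (\<lambda>k. (Del k, Eps (Suc i))) [1..<Suc l]"
  let ?xs = "as @ dels_desc l @ Eps (Suc i) # epss_desc i"
  let ?zs = "(as @ [Eps (Suc i)]) @ dels_desc l @ epss_desc i"
  have eq: "as @ dels_desc l @ epss_desc (Suc i) = ?xs" by simp
  have dist: "distinct ?xs" using 3(3) unfolding eq .
  then have "distinct ?zs" by (auto simp del: upt_Suc)
  then have rec: "odd_path ?zs (reflection_roots i ys)"
    "fold reflect (reflection_roots i ys) ?zs = (as @ [Eps (Suc i)]) @ ys"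
    using 3(2) by blast+
  have pass: "odd_path ?xs ?ps" "fold reflect ?ps ?xs = ?zs"
    using odd_path_pass_dels[OF dist] by (simp_all del: upt_Suc)
  show ?case
    unfolding eq reflection_roots_Eps[OF 3(1)] odd_path_append fold_append comp_apply pass(2)
    using pass(1) rec by simp
qed

lemma borel_op_eq: "borel_op m n = dels_desc (2 * n) @ epss_desc m"
  by (simp add: borel_op_def)

lemma borel_op_borel_sequence: "borel_op m n \<in> borel_sequences m n"
  by (auto simp: borel_op_def borel_sequences_def labels_def distinct_map inj_on_def simp del: upt_Suc)

lemma odd_path_borel_op:
  assumes "xs \<in> decreasing_borels m n"
  shows "odd_path (borel_op m n) (reflection_roots m xs)"
    and "fold reflect (reflection_roots m xs) (borel_op m n) = xs"
  using odd_path_reflection_roots[OF decreasing_borels_list[OF assms], of "[]"]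
    borel_op_borel_sequence[of m n]
  unfolding borel_op_eq borel_sequences_def by (simp_all del: upt_Suc)

lemma (in irreducible_fd_gl_supermodule) has_highest_weight_odd_path:
  assumes "odd_path xs ps" "xs \<in> borel_sequences m n" "has_highest_weight scale m n \<rho> xs \<mu>"
  shows "fold reflect ps xs \<in> borel_sequences m n \<and>
    has_highest_weight scale m n \<rho> (fold reflect ps xs) (fold (reflected_weight m n) ps \<mu>)"
  using assms
proof (induction ps arbitrary: xs \<mu>)
  case Nil
  then show ?case by simp
next
  case (Cons p ps)
  then obtain as k i bs where p: "p = (Del k, Eps i)" and xs: "xs = as @ Del k # Eps i # bs"
    by auto
  have dist: "distinct xs" using Cons.prems(2) by (simp add: borel_sequences_def)
  have ref: "reflect p xs = as @ Eps i # Del k # bs"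
    unfolding p xs using reflect_adjacent dist xs by blast
  have "reflect p xs \<in> borel_sequences m n"
    unfolding ref using Cons.prems(2) xs by (auto simp: borel_sequences_def)
  moreover have "has_highest_weight scale m n \<rho> (reflect p xs) (reflected_weight m n p \<mu>)"
    unfolding ref unfolding p by (rule odd_reflection[OF xs Cons.prems(2,3)])
  ultimately show ?case using Cons by simp
qed

section \<open>The subtracted roots\<close>

text \<open>The order in which the reflections are performed. It describes the roots used in the
  first \<open>t\<close> steps as a set, without reference to list positions.\<close>

definition root_before :: "label \<times> label \<Rightarrow> label \<times> label \<Rightarrow> bool" where
  "root_before p q \<longleftrightarrow> (\<exists>k i k' i'. p = (Del k, Eps i) \<and> q = (Del k', Eps i') \<and> (i' < i \<or> i = i' \<and> k < k'))"

lemma root_before_asym: "root_before p q \<Longrightarrow> \<not> root_before q p"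
  by (auto simp: root_before_def)

lemma set_reflection_roots:
  "set (reflection_roots m xs) = {(Del k, Eps i) | k i. 1 \<le> i \<and> i \<le> m \<and> 1 \<le> k \<and> k \<le> dels_right xs i}"
  by (force simp: reflection_roots_def simp del: upt_Suc)

lemma sorted_reflection_roots: "sorted_wrt root_before (reflection_roots m xs)"
proof (induction m)
  case (Suc m)
  have "sorted_wrt root_before (map (\<lambda>k. (Del k, Eps (Suc m))) [1..<Suc (dels_right xs (Suc m))])"
    by (simp add: sorted_wrt_map root_before_def del: upt_Suc)
  moreover have "root_before p q"
    if "p \<in> set (map (\<lambda>k. (Del k, Eps (Suc m))) [1..<Suc (dels_right xs (Suc m))])"
      "q \<in> set (reflection_roots m xs)" for p q
    using that by (auto simp: set_reflection_roots root_before_def simp del: upt_Suc)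
  ultimately show ?case using Suc unfolding reflection_roots_Suc sorted_wrt_append by blast
qed simp

text \<open>By asymmetry, an element related to \<open>xs ! t\<close> can occur neither at position
  \<open>t\<close> nor after it.\<close>

lemma set_take_sorted_wrt:
  assumes "sorted_wrt R xs" "t < length xs" "\<And>a b. R a b \<Longrightarrow> \<not> R b a"
  shows "set (take t xs) = {a \<in> set xs. R a (xs ! t)}"
proof safe
  fix a assume "a \<in> set (take t xs)"
  then show "a \<in> set xs" by (rule in_set_takeD)
  show "R a (xs ! t)"
    using \<open>a \<in> set (take t xs)\<close> assms(1,2) by (auto simp: in_set_conv_nth sorted_wrt_iff_nth_less)
next
  fix a assume "a \<in> set xs" "R a (xs ! t)"
  then obtain s where s: "s < length xs" "xs ! s = a" by (auto simp: in_set_conv_nth)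
  have "s < t"
    using assms s \<open>R a (xs ! t)\<close> by (metis linorder_neqE_nat sorted_wrt_iff_nth_less)
  then show "a \<in> set (take t xs)" using s assms(2) by (auto simp: in_set_conv_nth)
qed

lemma take_reflection_roots:
  assumes "t < length (reflection_roots m xs)" "reflection_roots m xs ! t = (Del k, Eps i)"
  shows "set (take t (reflection_roots m xs)) =
    {(Del k', Eps i') | k' i'. 1 \<le> i' \<and> i' \<le> m \<and> 1 \<le> k' \<and> k' \<le> dels_right xs i' \<and>
      (i < i' \<or> i = i' \<and> k' < k)}"
proof -
  have "set (take t (reflection_roots m xs)) =
      {a \<in> set (reflection_roots m xs). root_before a (Del k, Eps i)}"
    using set_take_sorted_wrt[OF sorted_reflection_roots assms(1) root_before_asym]
    unfolding assms(2) .
  then show ?thesis unfolding set_reflection_roots by (auto simp: root_before_def)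
qed

text \<open>Only the bound from the partition is stated; the other bounds on \<open>i\<close> and
  \<open>k\<close> come from intersecting with \<open>reflection_roots\<close>.\<close>

definition hook_roots :: "(nat \<Rightarrow> nat) \<Rightarrow> (label \<times> label) set" where
  "hook_roots lam = {(Del k, Eps i) | k i. k \<le> 2 * lam i}"

section \<open>Coordinates of the hook weight and the form at each reflection\<close>

lemma lookup_hook_weight_Eps:
  "1 \<le> i \<Longrightarrow> i \<le> m \<Longrightarrow> Poly_Mapping.lookup (hook_weight m n lam) (Eps i) = - of_nat (2 * lam i)"
  by (simp add: hook_weight_def lookup_minus lookup_uminus lookup_sum lookup_add lookup_single when_def)

text \<open>The indices \<open>2 * j - 1\<close> and \<open>2 * j\<close> share the coordinate of
  column \<open>j\<close>, and \<open>Suc k div 2\<close> is \<open>k / 2\<close> rounded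
  up.\<close>

lemma lookup_hook_weight_Del:
  assumes "1 \<le> k" "k \<le> 2 * n"
  shows "Poly_Mapping.lookup (hook_weight m n lam) (Del k) =
    - of_nat (transposed_part lam (Suc k div 2) - m)"
proof -
  let ?c = "\<lambda>j. of_nat (transposed_part lam j - m) :: complex"
  have "Poly_Mapping.lookup (hook_weight m n lam) (Del k) =
      - (\<Sum>j = 1..n. (if 2 * j - 1 = k then ?c j else 0) + (if 2 * j = k then ?c j else 0))"
    by (simp add: hook_weight_def lookup_minus lookup_uminus lookup_sum lookup_add lookup_single when_def
        del: of_nat_diff)
  also have "\<dots> = - (\<Sum>j = 1..n. if j = Suc k div 2 then ?c j else 0)"
    by (intro arg_cong[where f = uminus] sum.cong refl) (auto; presburger)
  also have "\<dots> = - ?c (Suc k div 2)" using assms by auto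
  finally show ?thesis .
qed

lemma partition_antimono:
  assumes "is_partition lam" "1 \<le> i" "i \<le> j"
  shows "lam j \<le> lam i"
  using assms(3)
proof (induction rule: dec_induct)
  case (step j)
  then show ?case using assms(1,2) by (meson is_partition_def le_trans)
qed simp

text \<open>Rows from \<open>i\<close> on are shorter than \<open>j\<close>, so only rows above row
  \<open>i\<close>, hence among the first \<open>m\<close>, are counted.\<close>

lemma transposed_part_le:
  assumes "is_partition lam" "1 \<le> i" "i \<le> m" "lam i < j"
  shows "transposed_part lam j \<le> m"
proof -
  have "{i. 1 \<le> i \<and> j \<le> lam i} \<subseteq> {1..m}"
  proof safe
    fix i' assume "1 \<le> i'" "j \<le> lam i'"
    then show "i' \<in> {1..m}" using partition_antimono[OF assms(1,2), of i'] assms(3,4) by force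
  qed
  from card_mono[OF _ this] show ?thesis by (simp add: transposed_part_def)
qed

lemma weight_form_partial:
  assumes part: "is_partition lam" and xs: "\<And>i. dels_right xs i \<le> 2 * n"
    and t: "t < length (reflection_roots m xs)" "reflection_roots m xs ! t = (Del k, Eps i)"
  defines "S \<equiv> set (take t (reflection_roots m xs)) \<inter> hook_roots lam"
  shows "weight_form m n (hook_weight m n lam - (\<Sum>p\<in>S. root p)) (root (Del k, Eps i)) \<noteq> 0 \<longleftrightarrow>
    k \<le> 2 * lam i"
proof -
  have "(Del k, Eps i) \<in> set (reflection_roots m xs)" using t nth_mem by metis
  then have ik: "1 \<le> i" "i \<le> m" "1 \<le> k" "k \<le> dels_right xs i" by (auto simp: set_reflection_roots)
  then have k: "k \<le> 2 * n" using xs le_trans by blast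
  have lab: "Del k \<in> labels m n" "Eps i \<in> labels m n" using ik k by (auto simp: labels_def)
  have fin: "finite S" by (simp add: S_def)
  have S_iff: "p \<in> S \<longleftrightarrow> (\<exists>k' i'. p = (Del k', Eps i') \<and> 1 \<le> i' \<and> i' \<le> m \<and> 1 \<le> k' \<and>
      k' \<le> dels_right xs i' \<and> (i < i' \<or> i = i' \<and> k' < k) \<and> k' \<le> 2 * lam i')" for p
    unfolding S_def take_reflection_roots[OF t] hook_roots_def by auto
  let ?D = "{p \<in> S. fst p = Del k}" and ?E = "{p \<in> S. snd p = Eps i}"
  have "Poly_Mapping.lookup (\<Sum>p\<in>S. root p) (Del k) = (\<Sum>p\<in>S. if fst p = Del k then 1 else 0)"
    unfolding lookup_sum by (intro sum.cong refl) (auto simp: S_iff lookup_root)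
  then have D: "Poly_Mapping.lookup (\<Sum>p\<in>S. root p) (Del k) = of_nat (card ?D)"
    using fin by (simp flip: sum.inter_filter)
  have "Poly_Mapping.lookup (\<Sum>p\<in>S. root p) (Eps i) = (\<Sum>p\<in>S. if snd p = Eps i then - 1 else 0)"
    unfolding lookup_sum by (intro sum.cong refl) (auto simp: S_iff lookup_root)
  then have E: "Poly_Mapping.lookup (\<Sum>p\<in>S. root p) (Eps i) = - of_nat (card ?E)"
    using fin by (simp flip: sum.inter_filter)
  \<comment> \<open>All \<open>k' < k\<close> for this \<open>i\<close> were reflected earlier, and
    those up to \<open>2 * lam i\<close> were subtracted.\<close>
  have "?E = (\<lambda>k'. (Del k', Eps i)) ` {1..min (k - 1) (2 * lam i)}"
    using ik by (force simp: S_iff)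
  then have cE: "card ?E = min (k - 1) (2 * lam i)"
    by (simp add: card_image inj_on_def)
  let ?h = "transposed_part lam (Suc k div 2) - m"
  \<comment> \<open>Only \<open>?E\<close> contributes negatively, so vanishing becomes an equation
    between natural numbers.\<close>
  have form: "weight_form m n (hook_weight m n lam - (\<Sum>p\<in>S. root p)) (root (Del k, Eps i)) =
      of_nat (?h + card ?D + 2 * lam i) - of_nat (card ?E)"
    unfolding weight_form_odd_root[OF lab] lookup_minus D E
      lookup_hook_weight_Eps[OF ik(1,2)] lookup_hook_weight_Del[OF ik(3) k]
    by (simp del: of_nat_diff)
  have "weight_form m n (hook_weight m n lam - (\<Sum>p\<in>S. root p)) (root (Del k, Eps i)) \<noteq> 0 \<longleftrightarrow>
      ?h + card ?D + 2 * lam i \<noteq> min (k - 1) (2 * lam i)"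
    unfolding form cE right_minus_eq of_nat_eq_iff ..
  also have "\<dots> \<longleftrightarrow> k \<le> 2 * lam i"
  proof (cases "k \<le> 2 * lam i")
    case True
    \<comment> \<open>As \<open>1 \<le> k\<close>, the right side is at most
      \<open>k - 1 < 2 * lam i\<close>.\<close>
    then show ?thesis using ik by simp
  next
    case False
    \<comment> \<open>From \<open>2 * lam i < k\<close> follows
      \<open>lam i < Suc k div 2\<close>.\<close>
    have "transposed_part lam (Suc k div 2) \<le> m"
      using False by (intro transposed_part_le[OF part ik(1,2)]) presburger
    moreover have "card ?D = 0"
    proof -
      \<comment> \<open>For \<open>i < i'\<close> the partition gives
        \<open>k' \<le> 2 * lam i' \<le> 2 * lam i < k\<close>.\<close>
      have "k \<noteq> k'" if "i < i' \<or> i = i' \<and> k' < k" "k' \<le> 2 * lam i'" for k' i'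
        using False that partition_antimono[OF part ik(1), of i'] by auto
      then have "?D = {}" by (auto simp: S_iff)
      then show ?thesis by (simp only: card.empty)
    qed
    ultimately show ?thesis using False by simp
  qed
  finally show ?thesis .
qed

lemma reflected_hook_weight:
  assumes "is_partition lam" "\<And>i. dels_right xs i \<le> 2 * n" "t \<le> length (reflection_roots m xs)"
  shows "fold (reflected_weight m n) (take t (reflection_roots m xs)) (hook_weight m n lam) =
    hook_weight m n lam - (\<Sum>p \<in> set (take t (reflection_roots m xs)) \<inter> hook_roots lam. root p)"
  using assms(3)
proof (induction t)
  case 0
  then show ?case by simp
next
  case (Suc t)
  let ?rr = "reflection_roots m xs"
  have t: "t < length ?rr" using Suc.prems by simp
  then obtain k i where p: "?rr ! t = (Del k, Eps i)"
    using nth_mem[OF t] by (auto simp: set_reflection_roots)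
  \<comment> \<open>Without repetition, one more step adds at most one new summand.\<close>
  have new: "(Del k, Eps i) \<notin> set (take t ?rr)" by (auto simp: take_reflection_roots[OF t p])
  have mem: "(Del k, Eps i) \<in> hook_roots lam \<longleftrightarrow> k \<le> 2 * lam i" by (auto simp: hook_roots_def)
  show ?case
    using Suc new mem weight_form_partial[OF assms(1,2) t p]
    by (auto simp: take_Suc_conv_app_nth[OF t] p reflected_weight_def Int_insert_left)
qed

theorem proposition4p9:
  fixes m n :: nat
    and lam :: "nat \<Rightarrow> nat"
    and \<bb> :: "label list"
    and scale :: "complex \<Rightarrow> 'v::ab_group_add \<Rightarrow> 'v"
    and W :: "bit \<Rightarrow> 'v set"
    and \<rho> :: "complex mat \<Rightarrow> 'v \<Rightarrow> 'v"
  assumes "\<bb> \<in> decreasing_borels m n"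
    and "lam \<in> hook_partitions m n"
    and "irreducible_fd_gl_supermodule scale m n W \<rho>"
    and "has_highest_weight scale m n \<rho> (borel_op m n) (hook_weight m n lam)"
  shows "subtracted_roots scale m n \<rho> \<bb> =
           {del k - eps i | i k. 1 \<le> i \<and> i \<le> m \<and> 1 \<le> k \<and> k \<le> min (dels_right \<bb> i) (2 * lam i)}
       \<and> subtracted_sum scale m n \<rho> \<bb> = (\<Sum>\<alpha> \<in> subtracted_roots scale m n \<rho> \<bb>. \<alpha>)
       \<and> has_highest_weight scale m n \<rho> \<bb> (hook_weight m n lam - subtracted_sum scale m n \<rho> \<bb>)
       \<and> highest_weight scale m n \<rho> \<bb> = hook_weight m n lam - subtracted_sum scale m n \<rho> \<bb>"
proof -
  interpret irreducible_fd_gl_supermodule scale m n W \<rho> by (rule assms(3))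
  let ?rr = "reflection_roots m \<bb>"
  have part: "is_partition lam" using assms(2) by (simp add: hook_partitions_def)
  have dels: "dels_right \<bb> i \<le> 2 * n" for i
  proof -
    have "{k. precedes \<bb> (Eps i) (Del k)} \<subseteq> {1..2 * n}"
      using assms(1) by (auto simp: decreasing_borels_def borel_sequences_def labels_def dest!: precedes_in_set)
    from card_mono[OF _ this] show ?thesis by (simp add: dels_right_def)
  qed
  \<comment> \<open>Every stage is treated, since each root is tested against the highest weight
    just before its own reflection.\<close>
  have hw: "intermediate_borel m n \<bb> t \<in> borel_sequences m n \<and>
      has_highest_weight scale m n \<rho> (intermediate_borel m n \<bb> t)
        (hook_weight m n lam - (\<Sum>p \<in> set (take t ?rr) \<inter> hook_roots lam. root p))"
    if "t \<le> length ?rr" for t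
  proof -
    have "odd_path (borel_op m n) (take t ?rr)"
      using odd_path_borel_op(1)[OF assms(1)] odd_path_append[of _ "take t ?rr" "drop t ?rr"] by simp
    then show ?thesis
      using has_highest_weight_odd_path[OF _ borel_op_borel_sequence assms(4)]
      unfolding intermediate_borel_def reflected_hook_weight[OF part dels that, symmetric] by blast
  qed
  have roots: "subtracted_roots scale m n \<rho> \<bb> = root ` (set ?rr \<inter> hook_roots lam)"
  proof -
    have "weight_form m n (highest_weight scale m n \<rho> (intermediate_borel m n \<bb> t)) (root (?rr ! t)) \<noteq> 0
        \<longleftrightarrow> ?rr ! t \<in> hook_roots lam" if t: "t < length ?rr" for t
    proof -
      obtain k i where p: "?rr ! t = (Del k, Eps i)"
        using nth_mem[OF t] by (auto simp: set_reflection_roots)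
      have "highest_weight scale m n \<rho> (intermediate_borel m n \<bb> t) =
          hook_weight m n lam - (\<Sum>p \<in> set (take t ?rr) \<inter> hook_roots lam. root p)"
        using hw[of t] t highest_weight_eqI by simp
      then show ?thesis
        using weight_form_partial[OF part dels t p] p by (simp add: hook_roots_def)
    qed
    then have "subtracted_roots scale m n \<rho> \<bb> =
        {root (?rr ! t) | t. t < length ?rr \<and> ?rr ! t \<in> hook_roots lam}"
      unfolding subtracted_roots_def by (intro Collect_cong ex_cong1) blast
    also have "\<dots> = root ` (set ?rr \<inter> hook_roots lam)"
      by (auto simp: set_conv_nth)
    finally show ?thesis .
  qed
  \<comment> \<open>\<open>subtracted_sum\<close> runs over a set of weights, so distinct pairs must
    give distinct roots for it to agree with the sum over pairs.\<close>
  have inj: "inj_on root (set ?rr \<inter> hook_roots lam)"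
  proof (rule inj_onI)
    fix p q assume "p \<in> set ?rr \<inter> hook_roots lam" "q \<in> set ?rr \<inter> hook_roots lam" and eq: "root p = root q"
    then obtain k i k' i' where pq: "p = (Del k, Eps i)" "q = (Del k', Eps i')"
      by (auto simp: set_reflection_roots)
    have "Poly_Mapping.lookup (root p) (Del k) = Poly_Mapping.lookup (root q) (Del k)"
      "Poly_Mapping.lookup (root p) (Eps i) = Poly_Mapping.lookup (root q) (Eps i)"
      using eq by simp_all
    then show "p = q" unfolding pq lookup_root by (auto split: if_splits)
  qed
  have sum: "subtracted_sum scale m n \<rho> \<bb> = (\<Sum>p \<in> set ?rr \<inter> hook_roots lam. root p)"
    unfolding subtracted_sum_def roots using sum.reindex[OF inj] by simp
  \<comment> \<open>The complete list of reflections ends at the given Borel subalgebra, so the last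
    stage gives the asserted highest weight.\<close>
  have final: "intermediate_borel m n \<bb> (length ?rr) = \<bb>"
    unfolding intermediate_borel_def using odd_path_borel_op(2)[OF assms(1)] by simp
  have hw_final: "\<bb> \<in> borel_sequences m n"
    "has_highest_weight scale m n \<rho> \<bb> (hook_weight m n lam - subtracted_sum scale m n \<rho> \<bb>)"
    using hw[of "length ?rr"] unfolding final sum by simp_all
  have "set ?rr \<inter> hook_roots lam = {(Del k, Eps i) | k i.
      1 \<le> i \<and> i \<le> m \<and> 1 \<le> k \<and> k \<le> min (dels_right \<bb> i) (2 * lam i)}"
    unfolding set_reflection_roots hook_roots_def by auto
  moreover have "root ` {(Del k, Eps i) | k i. P k i} = {del k - eps i | i k. P k i}" for P
    unfolding root_def by force
  ultimately have "subtracted_roots scale m n \<rho> \<bb> =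
      {del k - eps i | i k. 1 \<le> i \<and> i \<le> m \<and> 1 \<le> k \<and> k \<le> min (dels_right \<bb> i) (2 * lam i)}"
    unfolding roots by presburger
  then show ?thesis using hw_final highest_weight_eqI[OF hw_final] by (simp add: subtracted_sum_def)
qed

end
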